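(* For every integer $n\ge 2$, the random variable $J_n$ stochastically dominates $K_n$; that is, $\mathbf{P}(J_n\ge j)\ge \mathbf{P}(K_n\ge j)$ for all $j\in\mathbb{N}$. Here $K_n$ is the number of degree-biased cuts needed to erase a random recursive tree with $n$ vertices, and $J_n$ is the number of jumps of the random walk with a barrier at $n+1$ with step distribution $\mathbf{P}(\zeta=k)=\frac{H_{k-1}}{k(k+1)}$, $k\ge 2$ (all as defined in the context).
   Context: An increasing tree on $[n]=\{1,\dots,n\}$ is a rooted labeled tree with vertex set $[n]$ in which labels along any path away from the root increase (so the root is $1$). A random recursive tree $T_n$ is a uniformly random element of the set $I_n$ of increasing trees on $[n]$. Edges are directed towards the root; an edge is written $v_1v_2$ with $v_1<v_2$ (so $v_1$ is the parent of $v_2$). For a vertex $v$ of a tree $t$, $t^{(v)}$ is the subtree rooted at $v$, consisting of $v$ and all its descendants. Degree-biased cut: given an increasing tree $t$ (possibly with a vertex set of labels other than $[n]$) with at least two vertices, choose an edge $v_1v_2$ of $t$ uniformly at random. If $v_1$ is not the root, let $v_0$ be the parent of $v_1$ and set $t^{root}:=t\setminus(t^{(v_1)}\cup v_0v_1)$, the subtree containing the root after deleting $t^{(v_1)}$ and the edge $v_0v_1$. If $v_1$ is the root, set $t^{root}:=\emptyset$. Degree-biased process and $K_n$: for $n\ge 2$, let $G_0=T_n$ and, for $t\ge1$, let $G_t=G_{t-1}^{root}$ (obtained by a new degree-biased cut of $G_{t-1}$) if $|G_{t-1}|\ge 2$, and $G_t=G_{t-1}$ otherwise, where $|\cdot|$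 is the number of vertices. Then $K_n=\min\{t\ge 1: |G_t|\in\{0,1\}\}$. $J_n$: $H_m=\sum_{i=1}^m i^{-1}$. Let $\zeta$ be a random variable with $\mathbf{P}(\zeta=k)=\frac{H_{k-1}}{k(k+1)}$ for integers $k\ge 2$, and let $\xi_1,\xi_2,\dots$ be independent copies of $\zeta$. The random walk with a barrier at $m$ is defined by $R^{(m)}_0=0$ and $R^{(m)}_i=R^{(m)}_{i-1}+\xi_i\mathbf{1}_{\{R^{(m)}_{i-1}+\xi_i<m\}}$ for $i\ge1$. Then $J_n$ is the number of jumps of $(R^{(n+1)}_i)_{i\ge 0}$, i.e. $J_n=\sum_{i\ge 1}\mathbf{1}_{\{R^{(n+1)}_{i-1}+\xi_i\le n\}}$. *)

theory Defs
  imports "HOL-Probability.Probability"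
begin

section \<open>Increasing trees\<close>

text \<open>
  A rooted labelled tree is given by its vertex set and its set of edges, an edge being stored as
  the pair (parent, child). The empty tree (no vertices) is admitted as a value of this type, since
  it may result from a cut, but it has no root.
\<close>

record ltree =
  verts :: "nat set"
  edges :: "(nat \<times> nat) set"

definition empty_tree :: ltree where
  "empty_tree = \<lparr>verts = {}, edges = {}\<rparr>"

definition rooted_at :: "ltree \<Rightarrow> nat \<Rightarrow> bool" where
  "rooted_at t r \<longleftrightarrow>
     finite (verts t) \<and> r \<in> verts t \<and> edges t \<subseteq> verts t \<times> verts t \<and>
     (\<forall>u. (u, r) \<notin> edges t) \<and>
     (\<forall>v\<in>verts t - {r}. \<exists>!u. (u, v) \<in> edges t) \<and>
     (\<forall>v\<in>verts t. (r, v) \<in> (edges t)\<^sup>*)"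

text \<open>
  A pair in the transitive closure of the edge relation consists of two vertices \<open>v\<close>, \<open>w\<close> such that
  \<open>w\<close> is met strictly after \<open>v\<close> on a path away from the root.
\<close>

definition increasing_tree :: "ltree \<Rightarrow> bool" where
  "increasing_tree t \<longleftrightarrow>
     (\<exists>r. rooted_at t r) \<and> (\<forall>(v, w)\<in>(edges t)\<^sup>+. v < w)"

definition increasing_trees :: "nat \<Rightarrow> ltree set" where
  "increasing_trees n = {t. increasing_tree t \<and> verts t = {1..n}}"

lemma finite_increasing_trees: "finite (increasing_trees n)"
proof -
  have "increasing_trees n \<subseteq> (\<lambda>E. \<lparr>verts = {1..n}, edges = E\<rparr>) ` Pow ({1..n} \<times> {1..n})"
  proof
    fix t assume "t \<in> increasing_trees n"
    then have "verts t = {1..n}" "edges t \<subseteq> {1..n} \<times> {1..n}"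
      by (auto simp: increasing_trees_def increasing_tree_def rooted_at_def)
    then show "t \<in> (\<lambda>E. \<lparr>verts = {1..n}, edges = E\<rparr>) ` Pow ({1..n} \<times> {1..n})"
      by (intro image_eqI[where x = "edges t"]) (auto intro: ltree.equality)
  qed
  then show ?thesis by (rule finite_subset) auto
qed

lemma increasing_trees_nonempty: assumes "n \<ge> 1" shows "increasing_trees n \<noteq> {}"
proof -
  let ?t = "\<lparr>verts = {1..n}, edges = {1} \<times> {2..n}\<rparr>"
  have "(1, v) \<in> (edges ?t)\<^sup>*" if "v \<in> verts ?t" for v
  proof (cases "v = 1")
    case False
    then have "(1, v) \<in> edges ?t" using that by simp
    then show ?thesis by (rule r_into_rtrancl)
  qed simp
  moreover have "\<exists>!u. (u, v) \<in> edges ?t" if "v \<in> verts ?t - {1}" for v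
    using that by (intro ex1I[of _ 1]) auto
  moreover have "edges ?t \<subseteq> verts ?t \<times> verts ?t"
    using assms by auto
  moreover have "finite (verts ?t)" "1 \<in> verts ?t" "\<forall>u. (u, 1) \<notin> edges ?t"
    using assms by simp_all
  ultimately have "rooted_at ?t 1"
    unfolding rooted_at_def by blast
  moreover have "v < w" if "(v, w) \<in> (edges ?t)\<^sup>+" for v w
    using that by (rule trancl_induct) simp_all
  ultimately have "increasing_tree ?t"
    unfolding increasing_tree_def by blast
  then have "?t \<in> increasing_trees n"
    by (simp add: increasing_trees_def)
  then show ?thesis by blast
qed

definition random_recursive_tree :: "nat \<Rightarrow> ltree pmf" where
  "random_recursive_tree n = pmf_of_set (increasing_trees n)"

definition subtree :: "ltree \<Rightarrow> nat \<Rightarrow> ltree" where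
  "subtree t v =
     (let D = {w \<in> verts t. (v, w) \<in> (edges t)\<^sup>*}
      in \<lparr>verts = D, edges = edges t \<inter> (D \<times> D)\<rparr>)"


section \<open>Degree-biased cuts\<close>

text \<open>The result of the degree-biased cut of \<open>t\<close> when the chosen edge is \<open>v1v2\<close>.\<close>

definition cut_at :: "ltree \<Rightarrow> nat \<times> nat \<Rightarrow> ltree" where
  "cut_at t = (\<lambda>(v1, v2).
     if rooted_at t v1 then empty_tree
     else (let v0 = (THE u. (u, v1) \<in> edges t); s = subtree t v1
           in \<lparr>verts = verts t - verts s, edges = edges t - edges s - {(v0, v1)}\<rparr>))"

lemma edges_finite_nonempty:
  assumes "increasing_tree t" "card (verts t) \<ge> 2"
  shows "finite (edges t)" "edges t \<noteq> {}"
proof -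
  obtain r where r: "rooted_at t r" using assms(1) by (auto simp: increasing_tree_def)
  then show "finite (edges t)"
    unfolding rooted_at_def by (meson finite_SigmaI finite_subset)
  have "\<not> verts t \<subseteq> {r}"
    using assms(2) card_mono[of "{r}" "verts t"] by auto
  then show "edges t \<noteq> {}" using r by (auto simp: rooted_at_def)
qed

lemma increasing_tree_cut_at:
  assumes t: "increasing_tree t" and e: "e \<in> edges t" and ne: "\<not> rooted_at t (fst e)"
  shows "increasing_tree (cut_at t e)"
proof -
  obtain r where r: "rooted_at t r" using t by (auto simp: increasing_tree_def)
  obtain v1 v2 where e2: "e = (v1, v2)" by (cases e)
  define D where "D = {w \<in> verts t. (v1, w) \<in> (edges t)\<^sup>*}"
  have sub: "edges t \<subseteq> verts t \<times> verts t" using r by (auto simp: rooted_at_def)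
  have v1: "v1 \<in> verts t" "v1 \<noteq> r" using e e2 sub ne r by auto
  then obtain v0 where v0: "(v0, v1) \<in> edges t" "\<And>u. (u, v1) \<in> edges t \<Longrightarrow> u = v0"
    using r unfolding rooted_at_def by (metis DiffI singletonD)
  have the: "(THE u. (u, v1) \<in> edges t) = v0" using v0 by blast
  have uniq: "u = v" if "(u, w) \<in> edges t" "(v, w) \<in> edges t" for u v w
  proof -
    have "w \<in> verts t - {r}" using r that by (auto simp: rooted_at_def)
    with that r show ?thesis unfolding rooted_at_def by blast
  qed
  let ?s = "cut_at t e"
  have V: "verts ?s = verts t - D"
    using ne by (simp add: cut_at_def e2 subtree_def D_def Let_def)
  have E: "edges ?s = edges t - (D \<times> D) - {(v0, v1)}"
    using ne by (auto simp add: cut_at_def e2 subtree_def D_def Let_def the)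
  have Dcl: "w \<in> D" if "u \<in> D" "(u, w) \<in> edges t" for u w
    using that sub by (auto simp: D_def intro: rtrancl_into_rtrancl)
  have Dcl': "u \<in> D \<or> (u = v0 \<and> w = v1)" if "w \<in> D" "(u, w) \<in> edges t" for u w
  proof -
    from that(1) have "(v1, w) \<in> (edges t)\<^sup>*" by (simp add: D_def)
    then show ?thesis
    proof (cases rule: rtranclE)
      case base then show ?thesis using that v0 by auto
    next
      case (step y)
      then have "y = u" using uniq that by blast
      then show ?thesis using step that sub by (auto simp: D_def)
    qed
  qed
  have E': "edges ?s = edges t \<inter> (verts t - D) \<times> (verts t - D)"
  proof -
    have "v1 \<in> D" using v1 by (simp add: D_def)
    then show ?thesis unfolding E using sub Dcl Dcl' by blast
  qed
  have rD: "r \<notin> D"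
  proof
    assume "r \<in> D"
    then have "(v1, r) \<in> (edges t)\<^sup>*" by (simp add: D_def)
    then show False using v1 r by (auto elim: rtranclE simp: rooted_at_def)
  qed
  have reach: "v \<notin> D \<longrightarrow> (r, v) \<in> (edges ?s)\<^sup>*" if "(r, v) \<in> (edges t)\<^sup>*" for v
    using that
  proof (induction rule: rtrancl_induct)
    case (step y z)
    then show ?case using Dcl[of y z] sub unfolding E'
      by (auto intro: rtrancl_into_rtrancl)
  qed auto
  have "rooted_at ?s r"
    unfolding rooted_at_def
  proof (intro conjI ballI allI)
    fix v assume "v \<in> verts ?s - {r}"
    then have v: "v \<in> verts t - {r}" "v \<notin> D" by (auto simp: V)
    then obtain u where u: "(u, v) \<in> edges t" using r unfolding rooted_at_def by blast
    then have "(u, v) \<in> edges ?s" using v sub Dcl[of u v] by (auto simp: E')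
    then show "\<exists>!u. (u, v) \<in> edges ?s" using uniq by (auto simp: E')
  next
    fix v assume "v \<in> verts ?s"
    then show "(r, v) \<in> (edges ?s)\<^sup>*" using reach r by (auto simp: V rooted_at_def)
  qed (use r rD in \<open>auto simp: V E' rooted_at_def\<close>)
  moreover have "(edges ?s)\<^sup>+ \<subseteq> (edges t)\<^sup>+" by (rule trancl_mono_subset) (auto simp: E)
  ultimately show ?thesis using t unfolding increasing_tree_def by blast
qed

definition degree_biased_cut :: "ltree \<Rightarrow> ltree pmf" where
  "degree_biased_cut t = map_pmf (cut_at t) (pmf_of_set (edges t))"

definition degree_biased_step :: "ltree \<Rightarrow> ltree pmf" where
  "degree_biased_step t =
     (if card (verts t) \<ge> 2 then degree_biased_cut t else return_pmf t)"

text \<open>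
  The process \<open>G\<close> may live on any probability space; its law is that of the Markov chain
  which starts from a random recursive tree and whose transitions are fresh degree-biased cuts.
\<close>

locale degree_biased_process = prob_space M
  for M :: "'a measure" and n :: nat and G :: "nat \<Rightarrow> 'a \<Rightarrow> ltree" +
  assumes random_variable_G: "\<And>t. random_variable (count_space UNIV) (G t)"
    and initial_law: "\<And>s. \<P>(\<omega> in M. G 0 \<omega> = s) = pmf (random_recursive_tree n) s"
    and transition_law: "\<And>t g.
      \<P>(\<omega> in M. \<forall>i\<le>Suc t. G i \<omega> = g i) =
      \<P>(\<omega> in M. \<forall>i\<le>t. G i \<omega> = g i) * pmf (degree_biased_step (g t)) (g (Suc t))"

text \<open>
  The number of cuts, as a function of the trajectory. Almost every trajectory of the process
  reaches a tree with at most one vertex, so the minimum is over a nonempty set almost surely.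
\<close>

definition num_cuts :: "(nat \<Rightarrow> ltree) \<Rightarrow> nat" where
  "num_cuts g = (LEAST t. t \<ge> 1 \<and> card (verts (g t)) \<in> {0, 1})"


section \<open>The random walk with a barrier\<close>

text \<open>
  Steps are indexed from 1; the value \<open>x 0\<close> is never used. The probabilities
  \<open>H\<^bsub>k-1\<^esub> / (k (k + 1))\<close>, \<open>k \<ge> 2\<close>, add up to 1, so they determine the law of a step, and
  a step is almost surely at least 2.
\<close>

locale zeta_steps = prob_space N
  for N :: "'b measure" and \<xi> :: "nat \<Rightarrow> 'b \<Rightarrow> nat" +
  assumes indep_steps: "indep_vars (\<lambda>_. count_space UNIV) \<xi> {1..}"
    and step_law: "\<And>i k. i \<ge> 1 \<Longrightarrow> k \<ge> 2 \<Longrightarrow>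
      \<P>(\<omega> in N. \<xi> i \<omega> = k) = harm (k - 1) / (real k * (real k + 1))"

primrec barrier_walk :: "nat \<Rightarrow> (nat \<Rightarrow> nat) \<Rightarrow> nat \<Rightarrow> nat" where
  "barrier_walk m x 0 = 0"
| "barrier_walk m x (Suc i) =
     barrier_walk m x i + (if barrier_walk m x i + x (Suc i) < m then x (Suc i) else 0)"

text \<open>
  The number of jumps with barrier at \<open>n + 1\<close>; the summation index is shifted by one. The values
  are extended since the sum may diverge for a step sequence (on a null set) containing zeros.
\<close>

definition num_jumps :: "nat \<Rightarrow> (nat \<Rightarrow> nat) \<Rightarrow> ennreal" where
  "num_jumps n x = (\<Sum>i. if barrier_walk (n + 1) x i + x (Suc i) \<le> n then 1 else 0)"

end

theory Submission
  imports Defs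
begin

text \<open>
  Cut a random recursive tree with \<open>m\<close> vertices once. Given its label set, the remaining tree is
  again uniform among increasing trees (\<open>sum_cut_at\<close>), so the sizes form a Markov chain. Counting
  trees and root degrees shows that \<open>k\<close> vertices are removed, \<open>k < m\<close>, with probability
  \<open>m/(m-1) * P(\<zeta> = k)\<close> (\<open>sum_survive\<close>); with the remaining probability the tree is erased.

  Measure the position of the walk with barrier at \<open>n + 1\<close> by its distance \<open>r\<close> from \<open>n\<close>. Ignoring
  rejected steps, it moves from \<open>r\<close> to \<open>r - k\<close>, \<open>2 \<le> k \<le> r\<close>, with probability
  \<open>P(\<zeta> = k) / P(\<zeta> \<le> r)\<close>. By telescoping, \<open>P(\<zeta> \<le> r) = 1 - (H_r + 1)/(r + 1)\<close>, which is at
  most \<open>(r - 1)/r\<close>. Hence the walk is at least as likely as the cut chain to move to any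
  \<open>r - k > 0\<close> (\<open>zeta_cdf_le\<close>). Only a move to \<open>0\<close> may be likelier for the cuts, and nothing
  happens after it. Induction on the number of moves still to be made compares the two tail
  probabilities (\<open>cut_survival_le_jump_tail\<close>).

  What remains is to relate the recursions to the processes: an upper bound for the number of cuts
  by the Markov property (\<open>prob_num_cuts_le\<close>), and a lower bound for the number of jumps by
  independence of the steps (\<open>prob_num_jumps_ge\<close>).
\<close>

section \<open>Increasing trees on an arbitrary label set\<close>

text \<open>
  A cut leaves a tree whose labels are no longer an initial segment of the integers. Working with
  all finite label sets makes the induction over successive cuts possible without relabelling.
\<close>
definition trees_on :: "nat set \<Rightarrow> ltree set" where
  "trees_on S = {t. increasing_tree t \<and> verts t = S}"

text \<open>
  An increasing tree is the same as a choice, for each vertex other than the smallest one, of a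
  smaller vertex as its parent: following parents strictly decreases the label, hence ends at the
  minimum. This replaces reachability by a local condition on edges, in both directions.
\<close>
lemma trees_onI:
  assumes S: "finite S" "S \<noteq> {}" "verts t = S"
    and E: "\<And>u v. (u, v) \<in> edges t \<Longrightarrow> u \<in> S \<and> v \<in> S \<and> u < v"
    and par: "\<And>v. v \<in> S \<Longrightarrow> v \<noteq> Min S \<Longrightarrow> \<exists>!u. (u, v) \<in> edges t"
  shows "t \<in> trees_on S"
proof -
  have lt: "v < w" if "(v, w) \<in> (edges t)\<^sup>+" for v w
    using that by (induction rule: trancl_induct) (use E in force)+
  have reach: "(Min S, v) \<in> (edges t)\<^sup>*" if "v \<in> S" for v
    using that
  proof (induction v rule: less_induct)
    case (less v)
    show ?case
    proof (cases "v = Min S")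
      case False
      then obtain u where u: "(u, v) \<in> edges t" using par less.prems by blast
      then show ?thesis using less.IH[of u] E[OF u] by (auto intro: rtrancl_into_rtrancl)
    qed simp
  qed
  have "rooted_at t (Min S)"
    unfolding rooted_at_def
  proof (intro conjI allI ballI)
    show "(u, Min S) \<notin> edges t" for u
      using E[of u "Min S"] Min_le[OF S(1), of u] by fastforce
  qed (use S E par reach in auto)
  then show ?thesis using lt S by (auto simp: trees_on_def increasing_tree_def)
qed

lemma trees_onD:
  assumes "t \<in> trees_on S"
  shows trees_on_finite: "finite S" and trees_on_nonempty: "S \<noteq> {}"
    and trees_on_verts: "verts t = S"
    and trees_on_edge: "\<And>u v. (u, v) \<in> edges t \<Longrightarrow> u \<in> S \<and> v \<in> S \<and> u < v"
    and trees_on_parent: "\<And>v. v \<in> S \<Longrightarrow> v \<noteq> Min S \<Longrightarrow> \<exists>!u. (u, v) \<in> edges t"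
    and trees_on_parent_unique: "\<And>u u' v. (u, v) \<in> edges t \<Longrightarrow> (u', v) \<in> edges t \<Longrightarrow> u = u'"
    and trees_on_reach: "\<And>v. v \<in> S \<Longrightarrow> (Min S, v) \<in> (edges t)\<^sup>*"
    and trees_on_rooted_iff: "\<And>r. rooted_at t r \<longleftrightarrow> r = Min S"
proof -
  obtain r where r: "rooted_at t r" and inc: "\<And>v w. (v, w) \<in> (edges t)\<^sup>+ \<Longrightarrow> v < w"
    using assms by (auto simp: trees_on_def increasing_tree_def)
  show S: "finite S" "S \<noteq> {}" "verts t = S"
    using r assms by (auto simp: trees_on_def rooted_at_def)
  have le: "v \<le> w" if "(v, w) \<in> (edges t)\<^sup>*" for v w
    using that inc by (metis less_imp_le order_refl rtranclD)
  have root_min: "q = Min S" if "rooted_at t q" for q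
    using that S le by (intro Min_eqI[symmetric]) (auto simp: rooted_at_def)
  then show iff: "rooted_at t q \<longleftrightarrow> q = Min S" for q using r by auto
  have R: "rooted_at t (Min S)" using iff by simp
  show e: "u \<in> S \<and> v \<in> S \<and> u < v" if "(u, v) \<in> edges t" for u v
    using that R S inc by (auto simp: rooted_at_def)
  show p: "\<exists>!u. (u, v) \<in> edges t" if "v \<in> S" "v \<noteq> Min S" for v
    using R S that by (auto simp: rooted_at_def)
  show "u = u'" if "(u, v) \<in> edges t" "(u', v) \<in> edges t" for u u' v
    using p[of v] e that R by (metis rooted_at_def)
  show "(Min S, v) \<in> (edges t)\<^sup>*" if "v \<in> S" for v
    using R S that by (auto simp: rooted_at_def)
qed

lemma trees_on_edges_subset: "t \<in> trees_on S \<Longrightarrow> edges t \<subseteq> S \<times> S"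
  using trees_on_edge by fastforce

lemma finite_trees_on: "finite (trees_on S)"
proof (cases "finite S")
  case True
  have "trees_on S \<subseteq> (\<lambda>E. \<lparr>verts = S, edges = E\<rparr>) ` Pow (S \<times> S)"
  proof
    fix t assume t: "t \<in> trees_on S"
    then show "t \<in> (\<lambda>E. \<lparr>verts = S, edges = E\<rparr>) ` Pow (S \<times> S)"
      using trees_on_edges_subset[OF t] trees_on_verts[OF t]
      by (intro image_eqI[where x = "edges t"]) (auto intro: ltree.equality)
  qed
  then show ?thesis by (rule finite_subset) (use True in auto)
next
  case False
  then have "trees_on S = {}" using trees_on_finite by blast
  then show ?thesis by simp
qed

lemma finite_edges: "t \<in> trees_on S \<Longrightarrow> finite (edges t)"
  using trees_on_edges_subset trees_on_finite by (meson finite_SigmaI finite_subset)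

text \<open>
  Edges correspond to their lower end points, the vertices other than the root.
\<close>
lemma card_edges:
  assumes t: "t \<in> trees_on S"
  shows "card (edges t) = card S - 1"
proof -
  note D = trees_onD[OF t]
  have "snd ` edges t = S - {Min S}"
  proof (intro equalityI subsetI)
    fix v assume "v \<in> snd ` edges t"
    then obtain u where "(u, v) \<in> edges t" by force
    then have "u \<in> S" "v \<in> S" "u < v" using D(4) by auto
    then show "v \<in> S - {Min S}" using Min_le[OF D(1), of u] by auto
  next
    fix v assume "v \<in> S - {Min S}"
    then show "v \<in> snd ` edges t" using D(5)[of v] by force
  qed
  moreover have "inj_on snd (edges t)"
    using D(6) by (auto simp: inj_on_def)
  ultimately have "card (edges t) = card (S - {Min S})" by (metis card_image)
  then show ?thesis using D by simp
qed

section \<open>Counting trees and root degrees\<close>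

text \<open>
  The largest label is a leaf, and it may be attached to any other vertex; this is the usual growth
  rule of random recursive trees. Both enumerations below are inductions along it.
\<close>
lemma sum_trees_on_insert_max:
  fixes g :: "ltree \<Rightarrow> real"
  assumes D: "finite D" "D \<noteq> {}" and x: "\<And>d. d \<in> D \<Longrightarrow> d < x"
  shows "(\<Sum>t\<in>trees_on (insert x D). g t) =
    (\<Sum>t\<in>trees_on D. \<Sum>v\<in>D. g \<lparr>verts = insert x D, edges = insert (v, x) (edges t)\<rparr>)"
proof -
  have xD: "x \<notin> D" using x by blast
  have Min: "Min (insert x D) = Min D" using D x by (simp add: min_def) (meson Min_in leD)
  \<comment> \<open>Attach the new leaf, and conversely delete it while remembering its parent.\<close>
  define ext where "ext = (\<lambda>(t :: ltree, v). \<lparr>verts = insert x D, edges = insert (v, x) (edges t)\<rparr>)"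
  define res where "res = (\<lambda>t :: ltree. (\<lparr>verts = D, edges = edges t \<inter> D \<times> D\<rparr>, THE v. (v, x) \<in> edges t))"
  have "(\<Sum>t\<in>trees_on (insert x D). g t) = (\<Sum>p\<in>trees_on D \<times> D. g (ext p))"
  proof (rule sum.reindex_bij_witness[where i = ext and j = res])
    fix t assume t: "t \<in> trees_on (insert x D)"
    note T = trees_onD[OF t]
    obtain p where p: "(p, x) \<in> edges t"
      using T(5)[of x] Min D x xD by (metis Min_in insertI1)
    then have pD: "p \<in> D" using T(4) by fastforce
    have the: "(THE v. (v, x) \<in> edges t) = p" using p T(6) by blast
    have E: "edges t = insert (p, x) (edges t \<inter> D \<times> D)"
    proof -
      have "(u, v) = (p, x) \<or> (u, v) \<in> D \<times> D" if "(u, v) \<in> edges t" for u v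
        using T(4)[OF that] T(6)[OF p, of u] that x by force
      then show ?thesis using p by auto
    qed
    show "ext (res t) = t"
      using E T(3) by (intro ltree.equality) (auto simp: ext_def res_def the)
    have "\<lparr>verts = D, edges = edges t \<inter> D \<times> D\<rparr> \<in> trees_on D"
    proof (rule trees_onI)
      fix v assume v: "v \<in> D" "v \<noteq> Min D"
      then obtain u where u: "(u, v) \<in> edges t" using T(5)[of v] Min by auto
      then have "u \<in> D" using T(4)[OF u] v x by fastforce
      then show "\<exists>!u. (u, v) \<in> edges \<lparr>verts = D, edges = edges t \<inter> D \<times> D\<rparr>"
        using u v T(6) by auto
    qed (use D T(4) in auto)
    then show "res t \<in> trees_on D \<times> D" using pD by (simp add: res_def the)
    show "g (ext (res t)) = g t" by (simp add: \<open>ext (res t) = t\<close>)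
  next
    fix q assume "q \<in> trees_on D \<times> D"
    then obtain t v where q: "q = (t, v)" and t: "t \<in> trees_on D" and v: "v \<in> D" by auto
    note T = trees_onD[OF t]
    have nx: "(u, x) \<notin> edges t" for u using T(4) xD by blast
    have "(THE u. (u, x) \<in> insert (v, x) (edges t)) = v" using nx by auto
    moreover have "insert (v, x) (edges t) \<inter> D \<times> D = edges t"
      using trees_on_edges_subset[OF t] xD by auto
    ultimately show "res (ext q) = q"
      using T(3) by (auto simp: res_def ext_def q intro: ltree.equality)
    show "ext q \<in> trees_on (insert x D)"
    proof (rule trees_onI)
      fix w assume w: "w \<in> insert x D" "w \<noteq> Min (insert x D)"
      show "\<exists>!u. (u, w) \<in> edges (ext q)"
      proof (cases "w = x")
        case True then show ?thesis using nx by (auto simp: ext_def q)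
      next
        case False
        then show ?thesis using w Min T(5)[of w] by (auto simp: ext_def q)
      qed
    next
      fix a b assume "(a, b) \<in> edges (ext q)"
      then show "a \<in> insert x D \<and> b \<in> insert x D \<and> a < b"
        using T(4)[of a b] v x by (auto simp: ext_def q)
    qed (use D in \<open>auto simp: ext_def q\<close>)
  qed
  then show ?thesis by (simp add: sum.cartesian_product ext_def split_def)
qed

lemma trees_on_singleton: "trees_on {x} = {\<lparr>verts = {x}, edges = {}\<rparr>}"
proof (intro equalityI subsetI)
  fix t assume t: "t \<in> trees_on {x}"
  then have "edges t = {}" using trees_on_edge[OF t] by fastforce
  then show "t \<in> {\<lparr>verts = {x}, edges = {}\<rparr>}"
    using trees_on_verts[OF t] by (auto intro: ltree.equality)
next
  fix t :: ltree assume "t \<in> {\<lparr>verts = {x}, edges = {}\<rparr>}"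
  then show "t \<in> trees_on {x}" by (intro trees_onI) auto
qed

lemma card_trees_on:
  assumes "finite S" "S \<noteq> {}"
  shows "real (card (trees_on S)) = fact (card S - 1)"
  using assms
proof (induction S rule: finite_linorder_max_induct)
  case (insert x D)
  show ?case
  proof (cases "D = {}")
    case True then show ?thesis by (simp add: trees_on_singleton)
  next
    case False
    then have cD: "card D > 0" using insert by (simp add: card_gt_0_iff)
    have x: "x \<notin> D" using insert by blast
    have "real (card (trees_on (insert x D))) = (\<Sum>t\<in>trees_on (insert x D). 1)" by simp
    also have "\<dots> = real (card (trees_on D)) * real (card D)"
      by (subst sum_trees_on_insert_max) (use insert False in auto)
    also have "\<dots> = fact (card (insert x D) - 1)"
      using insert False x cD by (simp add: fact_reduce[of "card D"])
    finally show ?thesis .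
  qed
qed simp

definition root_edges :: "ltree \<Rightarrow> (nat \<times> nat) set" where
  "root_edges t = {e \<in> edges t. fst e = Min (verts t)}"

text \<open>
  The new largest leaf raises the root degree exactly when it is attached to the root, that is for
  one of the \<open>k\<close> possible parents. So the mean root degree grows by \<open>1/k\<close> at this step, which
  accounts for the harmonic number.
\<close>
lemma sum_root_degrees:
  assumes "finite S" "S \<noteq> {}"
  shows "(\<Sum>t\<in>trees_on S. real (card (root_edges t))) = fact (card S - 1) * harm (card S - 1)"
  using assms
proof (induction S rule: finite_linorder_max_induct)
  case (insert x D)
  show ?case
  proof (cases "D = {}")
    case True then show ?thesis by (simp add: trees_on_singleton root_edges_def harm_def)
  next
    case False
    have cD: "card D > 0" using insert False by (simp add: card_gt_0_iff)
    have x: "x \<notin> D" using insert by blast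
    have Min: "Min (insert x D) = Min D" using False insert by (simp add: min_def) (meson Min_in leD)
    have step: "real (card (root_edges \<lparr>verts = insert x D, edges = insert (v, x) (edges t)\<rparr>))
        = real (card (root_edges t)) + of_bool (v = Min D)"
      if t: "t \<in> trees_on D" for t v
    proof -
      have nx: "(v, x) \<notin> edges t" using trees_on_edge[OF t] x by blast
      have "root_edges \<lparr>verts = insert x D, edges = insert (v, x) (edges t)\<rparr>
          = (if v = Min D then insert (v, x) (root_edges t) else root_edges t)"
        using Min trees_on_verts[OF t] by (auto simp: root_edges_def)
      moreover have "finite (root_edges t)" using finite_edges[OF t] by (simp add: root_edges_def)
      ultimately show ?thesis using nx by (auto simp: root_edges_def)
    qed
    have "(\<Sum>t\<in>trees_on (insert x D). real (card (root_edges t)))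
        = (\<Sum>t\<in>trees_on D. \<Sum>v\<in>D. real (card (root_edges t)) + of_bool (v = Min D))"
      by (subst sum_trees_on_insert_max) (use insert False step in auto)
    also have "\<dots> = (\<Sum>t\<in>trees_on D. real (card D) * real (card (root_edges t)) + 1)"
      using insert False by (intro sum.cong refl) (simp add: sum.distrib of_bool_def)
    also have "\<dots> = real (card D) * (fact (card D - 1) * harm (card D - 1)) + fact (card D - 1)"
      using insert False by (simp add: sum.distrib flip: sum_distrib_left) (simp add: card_trees_on)
    also have "\<dots> = fact (card (insert x D) - 1) * harm (card (insert x D) - 1)"
    proof -
      obtain k where k: "card D = Suc k" using cD by (metis gr0_conv_Suc)
      show ?thesis using insert x by (simp add: k harm_Suc field_simps)
    qed
    finally show ?thesis .
  qed
qed simp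

section \<open>The splitting property of degree-biased cuts\<close>
definition graft :: "ltree \<Rightarrow> ltree \<Rightarrow> nat \<Rightarrow> ltree" where
  "graft s u v0 = \<lparr>verts = verts s \<union> verts u, edges = insert (v0, Min (verts u)) (edges s \<union> edges u)\<rparr>"

definition parent :: "ltree \<Rightarrow> nat \<Rightarrow> nat" where
  "parent t v = (THE u. (u, v) \<in> edges t)"

text \<open>
  A cut at an edge \<open>v1v2\<close> not incident with the root splits \<open>t\<close> into the surviving tree and the
  removed subtree, both increasing; grafting the latter back at the old parent \<open>v0\<close> of \<open>v1\<close>
  recovers \<open>t\<close>. The label \<open>v1\<close> is the smallest of the removed ones and \<open>v0 < v1\<close>, so \<open>v0\<close> is
  the minimum of \<open>v0\<close> together with the removed labels.
\<close>
lemma graft_cut_at: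
  assumes t: "t \<in> trees_on S" and e: "(v1, v2) \<in> edges t - root_edges t"
  defines "D \<equiv> verts (subtree t v1)"
  shows "D \<subseteq> S" "D \<noteq> {}" "Min D = v1" "parent t v1 \<in> S - D" "parent t v1 < v1"
    "subtree t v1 \<in> trees_on D" "cut_at t (v1, v2) \<in> trees_on (S - D)"
    "(v1, v2) \<in> root_edges (subtree t v1)"
    "graft (cut_at t (v1, v2)) (subtree t v1) (parent t v1) = t"
proof -
  note T = trees_onD[OF t]
  have v1: "v1 \<in> S" "v1 \<noteq> Min S" using e T(3) T(4)[of v1 v2] by (auto simp: root_edges_def)
  have Ddef: "D = {w \<in> S. (v1, w) \<in> (edges t)\<^sup>*}"
    by (simp add: D_def subtree_def T(3) Let_def)
  show DS: "D \<subseteq> S" by (auto simp: Ddef)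
  have v1D: "v1 \<in> D" using v1 by (simp add: Ddef)
  then show "D \<noteq> {}" by blast
  have finD: "finite D" using DS T(1) finite_subset by blast
  obtain v0 where v0: "(v0, v1) \<in> edges t" using T(5)[of v1] v1 by blast
  have pv0: "parent t v1 = v0" unfolding parent_def using v0 T(6) by blast
  have le: "v \<le> w" if "(v, w) \<in> (edges t)\<^sup>*" for v w
    using that
  proof (induction rule: rtrancl_induct)
    case (step y z)
    then show ?case using T(4)[of y z] by simp
  qed simp
  show minD: "Min D = v1"
    using finD v1D le by (intro Min_eqI) (auto simp: Ddef)
  show "parent t v1 < v1" using T(4)[OF v0] by (simp add: pv0)
  then have v0D: "v0 \<notin> D" using minD Min_le[OF finD, of v0] by (auto simp: pv0)
  then show "parent t v1 \<in> S - D" using T(4)[OF v0] by (simp add: pv0)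
  have D_out: "w \<in> D" if "u \<in> D" "(u, w) \<in> edges t" for u w
    using that T(4)[of u w] by (auto simp: Ddef intro: rtrancl_into_rtrancl)
  have D_in: "u \<in> D" if "w \<in> D" "w \<noteq> v1" "(u, w) \<in> edges t" for u w
  proof -
    have "(v1, w) \<in> (edges t)\<^sup>*" using that by (simp add: Ddef)
    then show ?thesis
    proof (cases rule: rtranclE)
      case (step y)
      then have "y = u" using T(6) that by blast
      then show ?thesis using step T(4)[OF that(3)] by (simp add: Ddef)
    qed (use that in simp)
  qed
  have subt: "subtree t v1 = \<lparr>verts = D, edges = edges t \<inter> D \<times> D\<rparr>"
    by (simp add: subtree_def D_def Let_def)
  show st: "subtree t v1 \<in> trees_on D"
    unfolding subt
  proof (rule trees_onI)
    fix v assume v: "v \<in> D" "v \<noteq> Min D"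
    have "v \<noteq> Min S" using v DS v1 T(1) minD v1D finD by (metis Min_antimono Min_eqI Min_in Min_le empty_iff le_antisym subsetD)
    then obtain u where u: "(u, v) \<in> edges t" using T(5)[of v] v DS by blast
    then have "u \<in> D" using D_in v minD by blast
    then show "\<exists>!u. (u, v) \<in> edges \<lparr>verts = D, edges = edges t \<inter> D \<times> D\<rparr>"
      using u v T(6) by auto
  qed (use finD v1D T(4) in auto)
  have nr: "\<not> rooted_at t v1" using T(8) v1 by simp
  have cut: "cut_at t (v1, v2) = \<lparr>verts = S - D, edges = edges t - (edges t \<inter> D \<times> D) - {(v0, v1)}\<rparr>"
    using nr pv0 by (simp add: cut_at_def parent_def subt T(3) Let_def)
  have "increasing_tree (cut_at t (v1, v2))"
    using increasing_tree_cut_at[of t "(v1, v2)"] e t nr by (auto simp: trees_on_def)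
  then show "cut_at t (v1, v2) \<in> trees_on (S - D)"
    by (simp add: trees_on_def cut)
  show "(v1, v2) \<in> root_edges (subtree t v1)"
    using e v1D D_out by (auto simp: root_edges_def subt minD)
  show "graft (cut_at t (v1, v2)) (subtree t v1) (parent t v1) = t"
    using DS T(3) v0 by (intro ltree.equality) (auto simp: graft_def cut subt pv0 minD)
qed

text \<open>
  Conversely two increasing trees on complementary label sets may be grafted at any vertex below
  the minimum of the second one, and a cut at a root edge of the second tree undoes this.
\<close>
lemma cut_at_graft:
  assumes s: "s \<in> trees_on (S - D)" and u: "u \<in> trees_on D" and D: "D \<subseteq> S"
    and v0: "v0 \<in> S - D" "v0 < Min D" and e: "e \<in> root_edges u"
  defines "t \<equiv> graft s u v0"
  shows "t \<in> trees_on S" "e \<in> edges t - root_edges t" "subtree t (fst e) = u"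
    "parent t (fst e) = v0" "cut_at t e = s"
proof -
  note Ts = trees_onD[OF s] and Tu = trees_onD[OF u]
  define v1 where "v1 = Min D"
  have v1D: "v1 \<in> D" using Tu(1,2) by (simp add: v1_def)
  have fe: "fst e = v1" using e Tu(3) by (simp add: root_edges_def v1_def)
  have finS: "finite S" using Ts(1) Tu(1) D by (metis Diff_partition finite_UnI)
  have Vt: "verts t = S" using Ts(3) Tu(3) D by (auto simp: t_def graft_def)
  have Et: "edges t = insert (v0, v1) (edges s \<union> edges u)"
    by (simp add: t_def graft_def v1_def Tu(3))
  have es: "edges s \<subseteq> (S - D) \<times> (S - D)" and eu: "edges u \<subseteq> D \<times> D"
    using trees_on_edges_subset s u by auto
  have noin: "(w, v1) \<notin> edges u" for w
    using Tu(4)[of w v1] Min_le[OF Tu(1), of w] by (auto simp: v1_def)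
  \<comment> \<open>The graft point lies below all of \<open>D\<close>, so the root survives.\<close>
  have minS: "Min S = Min (S - D)"
  proof (rule Min_eqI)
    show "Min (S - D) \<in> S" using Ts(1,2) Min_in by blast
    fix y assume y: "y \<in> S"
    show "Min (S - D) \<le> y"
    proof (cases "y \<in> D")
      case True
      then have "v0 \<le> y" using v0(2) Min_le[OF Tu(1) True] by simp
      then show ?thesis using Min_le[OF Ts(1) v0(1)] by simp
    qed (use y Ts(1) in auto)
  qed (rule finS)
  have v1S: "v1 \<noteq> Min S" using v1D Ts(1,2) Min_in minS by fastforce
  show tS: "t \<in> trees_on S"
  proof (rule trees_onI)
    fix a b assume "(a, b) \<in> edges t"
    then show "a \<in> S \<and> b \<in> S \<and> a < b"
      using Ts(4)[of a b] Tu(4)[of a b] D v0 v1D by (auto simp: Et v1_def)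
  next
    fix v assume v: "v \<in> S" "v \<noteq> Min S"
    consider "v \<in> S - D" | "v = v1" | "v \<in> D" "v \<noteq> v1" using v by blast
    then show "\<exists>!w. (w, v) \<in> edges t"
    proof cases
      case 1
      then have "(w, v) \<in> edges t \<longleftrightarrow> (w, v) \<in> edges s" for w
        using eu v1D by (auto simp: Et)
      then show ?thesis using Ts(5)[of v] 1 v minS by simp
    next
      case 2
      then have "(w, v) \<in> edges t \<longleftrightarrow> w = v0" for w
        using es v1D noin by (auto simp: Et)
      then show ?thesis by simp
    next
      case 3
      then have "(w, v) \<in> edges t \<longleftrightarrow> (w, v) \<in> edges u" for w
        using es by (auto simp: Et)
      then show ?thesis using Tu(5)[of v] 3 by (simp add: v1_def)
    qed
  qed (use finS Vt v1D D in auto)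
  show "e \<in> edges t - root_edges t"
    using e fe v1S Vt by (auto simp: root_edges_def Et)
  have desc: "(v1, w) \<in> (edges t)\<^sup>* \<longleftrightarrow> w \<in> D" for w
  proof
    assume "(v1, w) \<in> (edges t)\<^sup>*"
    then show "w \<in> D"
      by (induction rule: rtrancl_induct) (use v1D es eu v0 in \<open>auto simp: Et\<close>)
  next
    assume "w \<in> D"
    then have "(v1, w) \<in> (edges u)\<^sup>*" using Tu(7) by (simp add: v1_def)
    moreover have "edges u \<subseteq> edges t" by (auto simp: Et)
    ultimately show "(v1, w) \<in> (edges t)\<^sup>*" using rtrancl_mono by blast
  qed
  have "edges t \<inter> D \<times> D = edges u" using es eu v0 by (auto simp: Et)
  moreover have "{w \<in> S. w \<in> D} = D" using D by auto
  ultimately show sub: "subtree t (fst e) = u"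
    using Tu(3) by (auto simp: subtree_def Let_def fe desc Vt intro: ltree.equality)
  have "(w, v1) \<in> edges t \<longleftrightarrow> w = v0" for w
    using es v1D noin by (auto simp: Et)
  then show par: "parent t (fst e) = v0"
    by (simp add: parent_def fe)
  have "\<not> rooted_at t v1" using trees_on_rooted_iff[OF tS] v1S by simp
  moreover have "edges t - edges u - {(v0, v1)} = edges s"
    using es eu v1D by (auto simp: Et)
  moreover have "S - D = verts s" using Ts(3) by simp
  ultimately show "cut_at t e = s"
    using sub par Tu(3) Vt fe
    by (cases e) (auto simp: cut_at_def parent_def Let_def)
qed

text \<open>
  The two preceding lemmas give a bijection. A tree with a chosen edge not at the root corresponds
  to a set \<open>X\<close> of at least two labels (the removed labels and the parent \<open>v0 = Min X\<close> of the removed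
  subtree), a surviving tree \<open>s\<close>, a removed tree \<open>u\<close>, and a root edge of \<open>u\<close>, which is the chosen
  edge itself. Coding the pair of \<open>v0\<close> and the removed labels as the single set \<open>X\<close> turns the
  count of graft points into a plain binomial coefficient. Since \<open>s\<close> ranges freely over all trees
  on the surviving labels, the surviving tree is again uniform given its label set.
\<close>
lemma sum_cut_at:
  fixes g :: "ltree \<Rightarrow> real"
  assumes S: "finite S"
  shows "(\<Sum>t\<in>trees_on S. \<Sum>e\<in>edges t - root_edges t. g (cut_at t e)) =
    (\<Sum>X | X \<subseteq> S \<and> 2 \<le> card X.
       (\<Sum>s\<in>trees_on (S - (X - {Min X})). g s) *
       (\<Sum>u\<in>trees_on (X - {Min X}). real (card (root_edges u))))"
proof -
  define L where "L = (SIGMA t:trees_on S. edges t - root_edges t)"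
  define R where "R = (SIGMA X:{X. X \<subseteq> S \<and> 2 \<le> card X}.
    trees_on (S - (X - {Min X})) \<times> (SIGMA u:trees_on (X - {Min X}). root_edges u))"
  define fwd where "fwd = (\<lambda>(t, e :: nat \<times> nat).
    (insert (parent t (fst e)) (verts (subtree t (fst e))), cut_at t e, subtree t (fst e), e))"
  define bwd where "bwd = (\<lambda>(X :: nat set, s, u, e :: nat \<times> nat). (graft s u (Min X), e))"
  have finX: "finite {X. X \<subseteq> S \<and> 2 \<le> card X}" using S by simp
  have "(\<Sum>(t, e)\<in>L. g (cut_at t e)) = (\<Sum>(X, s, u, e)\<in>R. g s)"
  proof (rule sum.reindex_bij_witness[where i = bwd and j = fwd])
    fix p assume "p \<in> L"
    then obtain t v1 v2 where p: "p = (t, (v1, v2))" and t: "t \<in> trees_on S"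
      and e: "(v1, v2) \<in> edges t - root_edges t" by (auto simp: L_def)
    note G = graft_cut_at[OF t e]
    define D v0 where "D = verts (subtree t v1)" and "v0 = parent t v1"
    note G = G[folded D_def v0_def]
    have finD: "finite D" using G(1) S finite_subset by blast
    have Min: "Min (insert v0 D) = v0"
      using finD G(2,3,5) by simp
    show "bwd (fwd p) = p"
      using G(9) Min by (simp add: p fwd_def bwd_def flip: D_def v0_def)
    have "insert v0 D - {v0} = D" using G(4) by auto
    moreover have "2 \<le> card (insert v0 D)" 
      using finD G(2,4) by (simp add: Suc_le_eq card_gt_0_iff)
    ultimately show "fwd p \<in> R"
      using G by (auto simp: p fwd_def R_def Min simp flip: D_def v0_def)
    show "(case fwd p of (X, s, u, e) \<Rightarrow> g s) = (case p of (t, e) \<Rightarrow> g (cut_at t e))"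
      by (simp add: p fwd_def)
  next
    fix q assume "q \<in> R"
    then obtain X s u e where q: "q = (X, s, u, e)" and X: "X \<subseteq> S" "2 \<le> card X"
      and s: "s \<in> trees_on (S - (X - {Min X}))" and u: "u \<in> trees_on (X - {Min X})"
      and e: "e \<in> root_edges u" by (auto simp: R_def)
    have finX: "finite X" using X S finite_subset by blast
    have XMin: "Min X \<in> X" using finX X(2) by (intro Min_in) auto
    have lt: "Min X < Min (X - {Min X})"
      using trees_on_nonempty[OF u] finX by (subst Min_gr_iff) (auto simp: order_less_le)
    have "X - {Min X} \<subseteq> S" "Min X \<in> S - (X - {Min X})" using X XMin by auto
    note G = cut_at_graft[OF s u this lt e]
    have "insert (Min X) (X - {Min X}) = X" using XMin by auto
    then show "fwd (bwd q) = q" using G trees_on_verts[OF u] by (simp add: q fwd_def bwd_def)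
    show "bwd q \<in> L" using G by (simp add: q bwd_def L_def)
  qed
  moreover have "(\<Sum>(t, e)\<in>L. g (cut_at t e)) =
      (\<Sum>t\<in>trees_on S. \<Sum>e\<in>edges t - root_edges t. g (cut_at t e))"
    unfolding L_def by (rule sum.Sigma[symmetric]) (use finite_trees_on finite_edges in auto)
  moreover have "(\<Sum>(X, s, u, e)\<in>R. g s) = (\<Sum>X | X \<subseteq> S \<and> 2 \<le> card X.
      \<Sum>(s, u, e)\<in>trees_on (S - (X - {Min X})) \<times> (SIGMA u:trees_on (X - {Min X}). root_edges u). g s)"
  proof -
    have fr: "finite (root_edges u)" if "u \<in> trees_on Y" for u Y
      using finite_edges[OF that] by (simp add: root_edges_def)
    show ?thesis
      unfolding R_def
      by (subst sum.Sigma) (use finX fr finite_trees_on in \<open>auto intro!: finite_SigmaI simp: split_def\<close>)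
  qed
  moreover have "(\<Sum>(s, u, e)\<in>trees_on A \<times> (SIGMA u:trees_on B. root_edges u). g s) =
      (\<Sum>s\<in>trees_on A. g s) * (\<Sum>u\<in>trees_on B. real (card (root_edges u)))" for A B
  proof -
    have fr: "\<forall>u\<in>trees_on B. finite (root_edges u)"
      using finite_edges by (auto simp: root_edges_def)
    have "(\<Sum>(s, u, e)\<in>trees_on A \<times> (SIGMA u:trees_on B. root_edges u). g s)
      = (\<Sum>s\<in>trees_on A. \<Sum>(u, e)\<in>(SIGMA u:trees_on B. root_edges u). g s)"
      unfolding sum.cartesian_product by (intro sum.cong) auto
    also have "\<dots> = (\<Sum>s\<in>trees_on A. \<Sum>u\<in>trees_on B. \<Sum>e\<in>root_edges u. g s)"
      by (subst sum.Sigma) (use fr finite_trees_on in auto)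
    finally show ?thesis by (simp add: sum_product mult.commute)
  qed
  ultimately show ?thesis by simp
qed

section \<open>Survival of degree-biased cuts as a recursion on the size\<close>

text \<open>
  For \<open>k \<ge> 2\<close> this is the law of \<open>\<zeta>\<close>. It vanishes at \<open>k = 1\<close> because \<open>harm 0 = 0\<close>; in a
  cut this matches the fact that a single removed vertex would have no child edge to be chosen.
\<close>
definition zeta_weight :: "nat \<Rightarrow> real" where
  "zeta_weight k = harm (k - 1) / (real k * (real k + 1))"

text \<open>
  The probability that the tree still has at least two vertices after \<open>j\<close> cuts, starting from \<open>t\<close>.
\<close>
primrec survive :: "nat \<Rightarrow> ltree \<Rightarrow> real" where
  "survive 0 t = of_bool (2 \<le> card (verts t))"
| "survive (Suc j) t = (if 2 \<le> card (verts t)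
     then (\<Sum>e\<in>edges t. survive j (cut_at t e)) / real (card (edges t)) else 0)"

text \<open>
  The same probability for a random recursive tree with \<open>m\<close> vertices. The cut that erases
  everything contributes nothing, as \<open>cut_survival j 0 = 0\<close>; so the sum may run up to \<open>k = m\<close>
  and then has the shape of the recursion for the walk.
\<close>
primrec cut_survival :: "nat \<Rightarrow> nat \<Rightarrow> real" where
  "cut_survival 0 m = of_bool (2 \<le> m)"
| "cut_survival (Suc j) m = (if 2 \<le> m
     then real m / (real m - 1) * (\<Sum>k=2..m. zeta_weight k * cut_survival j (m - k)) else 0)"

lemma survive_empty_tree: "survive j empty_tree = 0"
  by (cases j) (simp_all add: empty_tree_def)

lemma cut_survival_small: "m < 2 \<Longrightarrow> cut_survival j m = 0"
  by (cases j) simp_all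

text \<open>
  In the splitting identity, the sets \<open>X\<close> with \<open>k + 1\<close> elements contribute, apart from the survival
  probability, \<open>(m choose (k + 1)) * (m - k - 1)! * (k - 1)! * H_(k-1) = m! * H_(k-1) / (k * (k + 1))\<close>:
  the first factorial counts the surviving trees, the second one together with the harmonic number
  counts the removed trees with a root edge. Dividing by the \<open>m - 1\<close> edges and the \<open>(m - 1)!\<close>
  trees yields the factor \<open>m / (m - 1)\<close>.
\<close>
lemma sum_survive:
  assumes "finite S" "S \<noteq> {}"
  shows "(\<Sum>t\<in>trees_on S. survive j t) = fact (card S - 1) * cut_survival j (card S)"
  using assms
proof (induction j arbitrary: S)
  case 0
  then show ?case using card_trees_on[OF 0] by (simp add: trees_on_verts of_bool_def)
next
  case (Suc j)
  define m where "m = card S"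
  show ?case
  proof (cases "2 \<le> m")
    case False
    then show ?thesis by (auto simp: trees_on_verts m_def intro!: sum.neutral)
  next
    case m: True
    \<comment> \<open>A cut at a root edge erases the tree, so it does not contribute.\<close>
    have split: "(\<Sum>e\<in>edges t. survive j (cut_at t e)) =
        (\<Sum>e\<in>edges t - root_edges t. survive j (cut_at t e))" if t: "t \<in> trees_on S" for t
    proof (rule sum.mono_neutral_right)
      show "\<forall>e\<in>edges t - (edges t - root_edges t). survive j (cut_at t e) = 0"
        using trees_on_rooted_iff[OF t] trees_on_verts[OF t]
        by (auto simp: root_edges_def cut_at_def survive_empty_tree)
    qed (use finite_edges[OF t] in auto)
    have inner: "(\<Sum>s\<in>trees_on (S - (X - {Min X})). survive j s) *
        (\<Sum>u\<in>trees_on (X - {Min X}). real (card (root_edges u)))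
      = fact (m - card X) * cut_survival j (m + 1 - card X) * (fact (card X - 2) * harm (card X - 2))"
      if X: "X \<subseteq> S" "2 \<le> card X" for X
    proof -
      have fX: "finite X" using X Suc.prems finite_subset by blast
      have mX: "Min X \<in> X" using fX X(2) by (intro Min_in) auto
      have le: "card X \<le> m" unfolding m_def using X Suc.prems by (intro card_mono) auto
      have c1: "card (X - {Min X}) = card X - 1" using mX by simp
      have "card (S - (X - {Min X})) = m - (card X - 1)"
        unfolding m_def c1[symmetric] using X fX by (intro card_Diff_subset) auto
      then have c2: "card (S - (X - {Min X})) = m + 1 - card X" using X by simp
      have "card (X - {Min X}) > 0" using c1 X by simp
      then have ne: "X - {Min X} \<noteq> {}" by force
      have ne2: "S - (X - {Min X}) \<noteq> {}" using mX X by auto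
      have "m + 1 - card X - 1 = m - card X" "card X - 1 - 1 = card X - 2" by auto
      then show ?thesis
        using Suc.IH[of "S - (X - {Min X})"] sum_root_degrees[of "X - {Min X}"] fX ne ne2 Suc.prems
        by (simp only: c1 c2 finite_Diff not_False_eq_True simp_thms)
    qed
    define F where "F c = fact (m - c) * cut_survival j (m + 1 - c) * (fact (c - 2) * harm (c - 2))" for c
    have "(\<Sum>X | X \<subseteq> S \<and> 2 \<le> card X. F (card X)) =
        (\<Sum>c=2..m. \<Sum>X | X \<in> {X. X \<subseteq> S \<and> 2 \<le> card X} \<and> card X = c. F (card X))"
      by (rule sum.group[symmetric]) (use Suc.prems in \<open>auto simp: m_def card_mono\<close>)
    also have "\<dots> = (\<Sum>c=2..m. real (m choose c) * F c)"
    proof (rule sum.cong[OF refl])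
      fix c assume c: "c \<in> {2..m}"
      have "{X \<in> {X. X \<subseteq> S \<and> 2 \<le> card X}. card X = c} = {X. X \<subseteq> S \<and> card X = c}"
        using c by auto
      then show "(\<Sum>X | X \<in> {X. X \<subseteq> S \<and> 2 \<le> card X} \<and> card X = c. F (card X)) = real (m choose c) * F c"
        using n_subsets[OF Suc.prems(1), of c] by (simp add: m_def)
    qed
    also have "\<dots> = (\<Sum>c=2..m. fact m * (zeta_weight (c - 1) * cut_survival j (m - (c - 1))))"
    proof (rule sum.cong[OF refl])
      fix c assume c: "c \<in> {2..m}"
      then obtain d where d: "c = Suc (Suc d)" by (metis atLeastAtMost_iff add_2_eq_Suc le_Suc_ex)
      have "fact c = (real d + 2) * (real d + 1) * fact d"
        by (simp add: d algebra_simps)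
      then have "real (m choose c) = fact m / ((real d + 2) * (real d + 1) * fact d * fact (m - c))"
        using c by (simp add: binomial_fact)
      moreover have "m + 1 - c = m - (c - 1)" using c by auto
      moreover have "zeta_weight (c - 1) = harm d / ((real d + 1) * (real d + 2))"
        by (simp add: zeta_weight_def d algebra_simps)
      ultimately show "real (m choose c) * F c = fact m * (zeta_weight (c - 1) * cut_survival j (m - (c - 1)))"
        by (simp add: F_def d mult_ac)
    qed
    also have "\<dots> = fact m * (\<Sum>c=2..m. zeta_weight (c - 1) * cut_survival j (m - (c - 1)))"
      by (simp add: sum_distrib_left)
    \<comment> \<open>With \<open>k = c - 1\<close>, the end terms \<open>k = m\<close> and \<open>k = 1\<close> are zero and may be added or dropped.\<close>
    also have "(\<Sum>c=2..m. zeta_weight (c - 1) * cut_survival j (m - (c - 1)))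
        = (\<Sum>k=1..m-1. zeta_weight k * cut_survival j (m - k))"
      by (rule sum.reindex_bij_witness[of _ Suc "\<lambda>c. c - 1"]) (use m in auto)
    also have "\<dots> = (\<Sum>k=1..m. zeta_weight k * cut_survival j (m - k))"
      by (rule sum.mono_neutral_left) (use m in \<open>auto simp: cut_survival_small\<close>)
    also have "\<dots> = (\<Sum>k=2..m. zeta_weight k * cut_survival j (m - k))"
    proof (rule sum.mono_neutral_right)
      have "k = 1" if "k \<in> {1..m} - {2..m}" for k using that by auto
      then show "\<forall>k\<in>{1..m} - {2..m}. zeta_weight k * cut_survival j (m - k) = 0"
        by (auto simp: zeta_weight_def harm_def)
    qed auto
    finally have X: "(\<Sum>X | X \<subseteq> S \<and> 2 \<le> card X. F (card X)) =
      fact m * (\<Sum>k=2..m. zeta_weight k * cut_survival j (m - k))" .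
    have "(\<Sum>t\<in>trees_on S. survive (Suc j) t) =
        (\<Sum>t\<in>trees_on S. (\<Sum>e\<in>edges t - root_edges t. survive j (cut_at t e)) / (real m - 1))"
      by (intro sum.cong refl) (use m split in \<open>auto simp: trees_on_verts card_edges m_def of_nat_diff\<close>)
    also have "\<dots> = (\<Sum>X | X \<subseteq> S \<and> 2 \<le> card X. F (card X)) / (real m - 1)"
      using sum_cut_at[OF Suc.prems(1), of "survive j"] inner
      by (simp add: F_def flip: sum_divide_distrib)
    also have "\<dots> = fact (m - 1) * cut_survival (Suc j) m"
      unfolding X using m by (simp add: fact_reduce[of m])
    finally show ?thesis by (simp only: m_def)
  qed
qed

section \<open>The degree-biased process\<close>

text \<open>
  The states of the process: cuts lead from increasing trees to increasing trees or the empty tree.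
\<close>
definition cut_tree :: "ltree \<Rightarrow> bool" where
  "cut_tree t \<longleftrightarrow> increasing_tree t \<or> t = empty_tree"

lemma cut_tree_edges:
  assumes "cut_tree t" "2 \<le> card (verts t)"
  shows "increasing_tree t" "finite (edges t)" "edges t \<noteq> {}"
proof -
  show "increasing_tree t" using assms by (auto simp: cut_tree_def empty_tree_def)
  then show "finite (edges t)" "edges t \<noteq> {}" using edges_finite_nonempty assms(2) by blast+
qed

lemma cut_tree_cut_at:
  assumes "cut_tree t" "2 \<le> card (verts t)" "e \<in> edges t"
  shows "cut_tree (cut_at t e)"
proof (cases "rooted_at t (fst e)")
  case True
  then have "cut_at t e = empty_tree" by (simp add: cut_at_def split_def)
  then show ?thesis by (simp add: cut_tree_def)
next
  case False
  then show ?thesis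
    using increasing_tree_cut_at[OF cut_tree_edges(1)[OF assms(1,2)] assms(3)]
    by (simp add: cut_tree_def)
qed

lemma expectation_degree_biased_step:
  fixes h :: "ltree \<Rightarrow> real"
  assumes "cut_tree t" "2 \<le> card (verts t)"
  shows "finite (set_pmf (degree_biased_step t))"
    "set_pmf (degree_biased_step t) = cut_at t ` edges t"
    "(\<Sum>s\<in>set_pmf (degree_biased_step t). pmf (degree_biased_step t) s * h s) =
       (\<Sum>e\<in>edges t. h (cut_at t e)) / real (card (edges t))"
proof -
  note e = cut_tree_edges[OF assms]
  have step: "degree_biased_step t = map_pmf (cut_at t) (pmf_of_set (edges t))"
    using assms(2) by (simp add: degree_biased_step_def degree_biased_cut_def)
  show set: "set_pmf (degree_biased_step t) = cut_at t ` edges t"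
    using e by (simp add: step)
  then show fin: "finite (set_pmf (degree_biased_step t))" using e by simp
  have "(\<Sum>s\<in>set_pmf (degree_biased_step t). pmf (degree_biased_step t) s * h s) =
      measure_pmf.expectation (degree_biased_step t) h"
    using fin by (subst integral_measure_pmf_real[where A = "set_pmf (degree_biased_step t)"])
      (auto simp: mult.commute)
  also have "\<dots> = (\<Sum>e\<in>edges t. h (cut_at t e)) / real (card (edges t))"
    using e by (simp add: step integral_pmf_of_set)
  finally show "(\<Sum>s\<in>set_pmf (degree_biased_step t). pmf (degree_biased_step t) s * h s) =
       (\<Sum>e\<in>edges t. h (cut_at t e)) / real (card (edges t))" .
qed

text \<open>
  The process takes values in an uncountable discrete space, so an event cannot simply be split
  over all values of a state. It can be split over a finite set of values that carries the whole
  mass of a larger event \<open>B\<close>.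
\<close>
lemma (in prob_space) prob_le_sum_slices:
  assumes A: "A \<in> events" and B: "B \<in> events" and "A \<subseteq> B" and F: "finite F"
    and Y: "random_variable (count_space UNIV) Y"
    and total: "(\<Sum>s\<in>F. prob (B \<inter> {\<omega>\<in>space M. Y \<omega> = s})) = prob B"
  shows "prob A \<le> (\<Sum>s\<in>F. prob (A \<inter> {\<omega>\<in>space M. Y \<omega> = s}))"
proof -
  have ev: "{\<omega>\<in>space M. Y \<omega> \<in> S} \<in> events" for S
    using measurable_sets[OF Y, of S] by (simp add: vimage_def Int_def conj_commute)
  have ev1: "{\<omega>\<in>space M. Y \<omega> = s} \<in> events" for s using ev[of "{s}"] by simp
  have slice: "prob (C \<inter> {\<omega>\<in>space M. Y \<omega> \<in> F}) = (\<Sum>s\<in>F. prob (C \<inter> {\<omega>\<in>space M. Y \<omega> = s}))"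
    if "C \<in> events" for C
  proof -
    have "C \<inter> {\<omega>\<in>space M. Y \<omega> \<in> F} = (\<Union>s\<in>F. C \<inter> {\<omega>\<in>space M. Y \<omega> = s})" by auto
    then show ?thesis
      using that F ev1 by (simp only:) (rule finite_measure_finite_Union, auto simp: disjoint_family_on_def)
  qed
  let ?F = "{\<omega>\<in>space M. Y \<omega> \<in> F}"
  have "prob (B - ?F) = 0"
    using slice[OF B] total finite_measure_Diff'[OF B ev[of F]] by simp
  moreover have "prob (A - ?F) \<le> prob (B - ?F)"
    using assms(3) B ev by (intro finite_measure_mono) auto
  ultimately have "prob (A - ?F) = 0" by (simp add: measure_le_0_iff)
  then have "prob A = prob (A \<inter> ?F)" using finite_measure_Diff'[OF A ev[of F]] by simp
  then show ?thesis using slice[OF A] by simp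
qed

context degree_biased_process begin

lemma event_G: "{\<omega>\<in>space M. P (G i \<omega>)} \<in> events"
  using measurable_sets[OF random_variable_G[of i], of "Collect P"]
  by (simp add: vimage_def Int_def conj_commute)

lemma event_finite_Ball: "finite I \<Longrightarrow> {\<omega>\<in>space M. \<forall>i\<in>I. P i (G i \<omega>)} \<in> events"
  by (rule sets.sets_Collect_finite_All[OF event_G])

abbreviation path_event :: "nat \<Rightarrow> (nat \<Rightarrow> ltree) \<Rightarrow> 'a set" where
  "path_event t g \<equiv> {\<omega>\<in>space M. \<forall>i\<le>t. G i \<omega> = g i}"

abbreviation big_between :: "nat \<Rightarrow> nat \<Rightarrow> 'a set" where
  "big_between t u \<equiv> {\<omega>\<in>space M. \<forall>i\<in>{t..u}. 2 \<le> card (verts (G i \<omega>))}"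

lemma event_path: "path_event t g \<in> events"
  using event_finite_Ball[OF finite_atMost, of t "\<lambda>i s. s = g i"]
  by (simp only: Ball_def atMost_iff)

lemma event_big: "big_between t u \<in> events"
  by (rule event_finite_Ball[OF finite_atLeastAtMost])

text \<open>
  The Markov property for survival. The law of the process is given on cylinders, so the past is a
  prescribed path \<open>g\<close>, extended by one state in each step of the induction on the time horizon.
\<close>
lemma prob_path_survive:
  assumes "cut_tree (g t)"
  shows "prob (path_event t g \<inter> big_between t (t + j)) \<le> prob (path_event t g) * survive j (g t)"
  using assms
proof (induction j arbitrary: t g)
  case 0
  show ?case
  proof (cases "2 \<le> card (verts (g t))")
    case True
    then show ?thesis by (auto intro!: finite_measure_mono event_path)
  next
    case False
    then have "path_event t g \<inter> big_between t (t + 0) = {}" by auto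
    then show ?thesis using False by simp
  qed
next
  case (Suc j)
  show ?case
  proof (cases "2 \<le> card (verts (g t))")
    case False
    then have "path_event t g \<inter> big_between t (t + Suc j) = {}"
      by (force dest: bspec[where x = t])
    then show ?thesis using False by (simp only: measure_empty) simp
  next
    case True
    define P where "P = degree_biased_step (g t)"
    note step = expectation_degree_biased_step[OF Suc.prems True, folded P_def]
    define ext where "ext s = g(Suc t := s)" for s
    have slice: "path_event t g \<inter> {\<omega>\<in>space M. G (Suc t) \<omega> = s} = path_event (Suc t) (ext s)" for s
      by (auto simp: ext_def le_Suc_eq)
    have prob_ext: "prob (path_event (Suc t) (ext s)) = prob (path_event t g) * pmf P s" for s
    proof -
      have "path_event t (ext s) = path_event t g" by (auto simp: ext_def)
      then show ?thesis
        using transition_law[of t "ext s"] by (simp add: ext_def P_def)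
    qed
    have "prob (path_event t g \<inter> big_between t (t + Suc j)) \<le>
        (\<Sum>s\<in>set_pmf P. prob (path_event t g \<inter> big_between t (t + Suc j) \<inter> {\<omega>\<in>space M. G (Suc t) \<omega> = s}))"
    proof (rule prob_le_sum_slices[where B = "path_event t g"])
      show "(\<Sum>s\<in>set_pmf P. prob (path_event t g \<inter> {\<omega>\<in>space M. G (Suc t) \<omega> = s})) = prob (path_event t g)"
        using step(1) sum_pmf_eq_1[OF step(1) order_refl]
        by (simp add: slice prob_ext flip: sum_distrib_left)
    qed (use event_path event_big step(1) random_variable_G in auto)
    also have "\<dots> \<le> (\<Sum>s\<in>set_pmf P. prob (path_event t g) * (pmf P s * survive j s))"
    proof (rule sum_mono)
      fix s assume "s \<in> set_pmf P"
      then have "cut_tree (ext s (Suc t))"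
        using cut_tree_cut_at[OF Suc.prems True] step(2) by (auto simp: ext_def)
      note IH = Suc.IH[of "ext s" "Suc t", OF this]
      have "prob (path_event t g \<inter> big_between t (t + Suc j) \<inter> {\<omega>\<in>space M. G (Suc t) \<omega> = s})
          \<le> prob (path_event (Suc t) (ext s) \<inter> big_between (Suc t) (Suc t + j))"
      proof (intro finite_measure_mono sets.Int event_path event_big subsetI)
        fix \<omega> assume w: "\<omega> \<in> path_event t g \<inter> big_between t (t + Suc j) \<inter> {\<omega>\<in>space M. G (Suc t) \<omega> = s}"
        then have "\<omega> \<in> path_event (Suc t) (ext s)" using slice by blast
        moreover have "\<omega> \<in> big_between (Suc t) (Suc t + j)" using w by simp
        ultimately show "\<omega> \<in> path_event (Suc t) (ext s) \<inter> big_between (Suc t) (Suc t + j)" by blast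
      qed
      also note IH
      finally show "prob (path_event t g \<inter> big_between t (t + Suc j) \<inter> {\<omega>\<in>space M. G (Suc t) \<omega> = s})
          \<le> prob (path_event t g) * (pmf P s * survive j s)"
        unfolding prob_ext by (simp add: ext_def mult.assoc)
    qed
    also have "\<dots> = prob (path_event t g) * survive (Suc j) (g t)"
      using step(3)[of "survive j"] True by (simp flip: sum_distrib_left)
    finally show ?thesis .
  qed
qed

text \<open>
  If more than \<open>j\<close> cuts are needed then \<open>G 1\<close>, ..., \<open>G j\<close> have at least two vertices. This also
  holds on trajectories that never reach a small tree, whatever the value of the \<open>LEAST\<close> there.
\<close>
lemma prob_num_cuts_le:
  assumes n: "2 \<le> n"
  shows "\<P>(\<omega> in M. Suc j \<le> num_cuts (\<lambda>t. G t \<omega>)) \<le> cut_survival j n"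
proof -
  define I where "I = increasing_trees n"
  have I: "I = trees_on {1..n}" by (auto simp: I_def increasing_trees_def trees_on_def)
  have finI: "finite I" and neI: "I \<noteq> {}"
    using finite_increasing_trees increasing_trees_nonempty n by (auto simp: I_def)
  have law: "prob (space M \<inter> {\<omega>\<in>space M. G 0 \<omega> = s}) = pmf (random_recursive_tree n) s" for s
    using initial_law[of s] by (simp add: Int_absorb1 Int_absorb)
  have "\<P>(\<omega> in M. Suc j \<le> num_cuts (\<lambda>t. G t \<omega>)) \<le> prob (big_between 1 j)"
  proof (intro finite_measure_mono event_big subsetI)
    fix \<omega> assume w: "\<omega> \<in> {\<omega>\<in>space M. Suc j \<le> num_cuts (\<lambda>t. G t \<omega>)}"
    have "2 \<le> card (verts (G i \<omega>))" if "i \<in> {1..j}" for i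
    proof (rule ccontr)
      assume "\<not> 2 \<le> card (verts (G i \<omega>))"
      then have "i \<ge> 1 \<and> card (verts (G i \<omega>)) \<in> {0, 1}" using that by auto
      then have "num_cuts (\<lambda>t. G t \<omega>) \<le> i" unfolding num_cuts_def by (rule Least_le)
      then show False using w that by simp
    qed
    then show "\<omega> \<in> big_between 1 j" using w by simp
  qed
  also have "\<dots> \<le> (\<Sum>s\<in>I. prob (big_between 1 j \<inter> {\<omega>\<in>space M. G 0 \<omega> = s}))"
  proof (rule prob_le_sum_slices[where B = "space M"])
    show "(\<Sum>s\<in>I. prob (space M \<inter> {\<omega>\<in>space M. G 0 \<omega> = s})) = prob (space M)"
      unfolding law random_recursive_tree_def prob_space
      by (rule sum_pmf_eq_1) (use finI neI in \<open>auto simp: I_def\<close>)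
  qed (use event_big finI random_variable_G in auto)
  also have "\<dots> \<le> (\<Sum>s\<in>I. survive j s / real (card I))"
  proof (rule sum_mono)
    fix s assume s: "s \<in> I"
    then have "cut_tree s" and card: "card (verts s) = n"
      by (auto simp: I_def increasing_trees_def cut_tree_def)
    have "prob (big_between 1 j \<inter> {\<omega>\<in>space M. G 0 \<omega> = s})
        \<le> prob (path_event 0 (\<lambda>_. s) \<inter> big_between 0 (0 + j))"
    proof (intro finite_measure_mono sets.Int event_path event_big subsetI)
      fix \<omega> assume w: "\<omega> \<in> big_between 1 j \<inter> {\<omega>\<in>space M. G 0 \<omega> = s}"
      have "2 \<le> card (verts (G i \<omega>))" if "i \<le> j" for i
        using w that n card by (cases i) auto
      then show "\<omega> \<in> path_event 0 (\<lambda>_. s) \<inter> big_between 0 (0 + j)"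
        using w by simp
    qed
    also have "\<dots> \<le> prob (path_event 0 (\<lambda>_. s)) * survive j s"
      by (rule prob_path_survive) fact
    also have "prob (path_event 0 (\<lambda>_. s)) = 1 / real (card I)"
      using initial_law[of s] s finI neI by (simp add: random_recursive_tree_def I_def)
    finally show "prob (big_between 1 j \<inter> {\<omega>\<in>space M. G 0 \<omega> = s}) \<le> survive j s / real (card I)"
      by simp
  qed
  also have "\<dots> = cut_survival j n"
    using sum_survive[of "{1..n}" j] card_trees_on[of "{1..n}"] n
    by (simp add: I flip: sum_divide_distrib)
  finally show ?thesis .
qed

end

section \<open>The number of jumps as a recursion\<close>

text \<open>
  This is the tail of the law of \<open>\<zeta>\<close> (see \<open>zeta_cdf_eq\<close>); it tends to zero since the harmonic
  numbers grow logarithmically.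
\<close>
lemma harm_over_n_tendsto_0: "(\<lambda>n. (harm n + 1) / real (n + 1)) \<longlonglongrightarrow> 0"
proof -
  have "(\<lambda>n. (harm n - ln (real n)) / real (n + 1) + (ln (real n) + 1) / real (n + 1)) \<longlonglongrightarrow> 0 + 0"
  proof (intro tendsto_add)
    show "(\<lambda>n. (harm n - ln (real n)) / real (n + 1)) \<longlonglongrightarrow> 0"
      using euler_mascheroni_LIMSEQ
      by (rule tendsto_divide_0) (rule filterlim_compose[OF filterlim_at_top_imp_at_infinity[OF filterlim_real_sequentially] filterlim_add_const_nat_at_top, of 1, unfolded])
    show "(\<lambda>n. (ln (real n) + 1) / real (n + 1)) \<longlonglongrightarrow> 0"
      by real_asymp
  qed
  then show ?thesis by (simp add: add_divide_distrib[symmetric])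
qed

definition zeta_cdf :: "nat \<Rightarrow> real" where
  "zeta_cdf r = (\<Sum>k=2..r. zeta_weight k)"

lemma zeta_weight_nonneg: "0 \<le> zeta_weight k"
  by (simp add: zeta_weight_def harm_nonneg)

text \<open>
  The series telescopes: \<open>1/(k(k+1)) = 1/k - 1/(k+1)\<close>, and summation by parts applies to \<open>harm\<close>.
\<close>
lemma zeta_cdf_eq:
  assumes "1 \<le> r"
  shows "zeta_cdf r = 1 - (harm r + 1) / real (r + 1)"
  using assms
proof (induction r rule: nat_induct_at_least)
  case base
  show ?case by (simp add: zeta_cdf_def harm_def)
next
  case (Suc r)
  have "zeta_cdf (Suc r) = zeta_cdf r + zeta_weight (Suc r)"
    using Suc.hyps by (simp add: zeta_cdf_def)
  also have "\<dots> = 1 - (harm (Suc r) + 1) / real (Suc r + 1)"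
  proof -
    have "1 - (h + 1) / (x + 1) + h / ((x + 1) * (x + 2)) = 1 - (h + 1 / (x + 1) + 1) / (x + 2)"
      if "0 \<le> x" for h x :: real
    proof -
      have "x + 1 \<noteq> 0" "x + 2 \<noteq> 0" using that by auto
      then show ?thesis by (simp add: divide_simps) (simp add: algebra_simps)
    qed
    from this[of "real r" "harm r"] show ?thesis
      unfolding Suc.IH by (simp add: zeta_weight_def harm_Suc inverse_eq_divide add_ac)
  qed
  finally show ?case .
qed

lemma zeta_cdf_tendsto: "zeta_cdf \<longlonglongrightarrow> 1"
proof (rule Lim_transform_eventually)
  show "(\<lambda>r. 1 - (harm r + 1) / real (r + 1)) \<longlonglongrightarrow> 1"
    using tendsto_diff[OF tendsto_const harm_over_n_tendsto_0, of 1] by simp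
  show "\<forall>\<^sub>F r in sequentially. 1 - (harm r + 1) / real (r + 1) = zeta_cdf r"
    using eventually_ge_at_top[of 1] by eventually_elim (simp add: zeta_cdf_eq)
qed

lemma zeta_cdf_le_1: "zeta_cdf r \<le> 1"
proof (cases "1 \<le> r")
  case True then show ?thesis by (simp add: zeta_cdf_eq harm_nonneg)
next
  case False then show ?thesis by (simp add: zeta_cdf_def)
qed

lemma zeta_cdf_pos:
  assumes "2 \<le> r" shows "0 < zeta_cdf r"
proof -
  have "0 < zeta_weight 2" by (simp add: zeta_weight_def harm_def)
  also have "\<dots> \<le> zeta_cdf r"
    unfolding zeta_cdf_def using assms zeta_weight_nonneg by (intro member_le_sum) auto
  finally show ?thesis .
qed

text \<open>
  The comparison of the two chains. The walk at distance \<open>r\<close> from the highest admissible position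
  jumps by \<open>k\<close> with conditional probability \<open>zeta_weight k / zeta_cdf r\<close>, the cut of a tree of size
  \<open>r\<close> removes \<open>k < r\<close> vertices with probability \<open>zeta_weight k * r / (r - 1)\<close>. The inequality says
  that the former is the larger one; it amounts to \<open>r * harm r \<ge> 1\<close>.
\<close>
lemma zeta_cdf_le:
  assumes "2 \<le> r" shows "zeta_cdf r * (real r / (real r - 1)) \<le> 1"
proof -
  have "harm 1 \<le> (harm r :: real)" using assms by (intro harm_mono) auto
  then have "1 \<le> (harm r :: real)" by (simp add: harm_def)
  then have "1 / real r \<le> (harm r + 1) / real (r + 1)"
  proof -
    have "real (r + 1) \<le> real r + real r * 1" using assms by simp
    also have "\<dots> \<le> real r + real r * harm r" using \<open>1 \<le> harm r\<close> by (intro add_left_mono mult_left_mono) auto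
    finally show ?thesis using assms by (simp add: field_simps)
  qed
  then have "zeta_cdf r \<le> 1 - 1 / real r" using zeta_cdf_eq[of r] assms by simp
  then have "zeta_cdf r * (real r / (real r - 1)) \<le> (1 - 1 / real r) * (real r / (real r - 1))"
    using assms by (intro mult_right_mono) auto
  also have "\<dots> = 1" using assms by (simp add: field_simps)
  finally show ?thesis .
qed

text \<open>
  The probability that \<open>N\<close> steps contain at least \<open>j\<close> jumps when the walk is at distance \<open>r\<close> below
  the highest admissible position. A step larger than \<open>r\<close> is rejected and leaves the position
  unchanged. The finite horizon \<open>N\<close> makes this a recursion in spite of the rejected steps.
\<close>
fun jump_prob :: "nat \<Rightarrow> nat \<Rightarrow> nat \<Rightarrow> real" where
  "jump_prob N 0 r = 1"
| "jump_prob 0 (Suc j) r = 0"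
| "jump_prob (Suc N) (Suc j) r =
     (\<Sum>k=2..r. zeta_weight k * jump_prob N j (r - k)) + (1 - zeta_cdf r) * jump_prob N (Suc j) r"

lemma jump_prob_nonneg: "0 \<le> jump_prob N j r"
  by (induction N j r rule: jump_prob.induct)
    (auto intro!: add_nonneg_nonneg sum_nonneg mult_nonneg_nonneg zeta_weight_nonneg simp: zeta_cdf_le_1)

lemma jump_prob_le_1: "jump_prob N j r \<le> 1"
proof (induction N j r rule: jump_prob.induct)
  case (3 N j r)
  have "jump_prob (Suc N) (Suc j) r \<le> (\<Sum>k=2..r. zeta_weight k * 1) + (1 - zeta_cdf r) * 1"
    unfolding jump_prob.simps using 3
    by (intro add_mono sum_mono mult_left_mono) (auto simp: zeta_weight_nonneg zeta_cdf_le_1)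
  then show ?case by (simp add: zeta_cdf_def)
qed auto

lemma jump_prob_mono_Suc: "jump_prob N j r \<le> jump_prob (Suc N) j r"
proof (induction N j r rule: jump_prob.induct)
  case (3 N j r)
  then show ?case
    unfolding jump_prob.simps
    by (intro add_mono sum_mono mult_left_mono) (auto simp: zeta_weight_nonneg zeta_cdf_le_1)
qed (auto simp: jump_prob_nonneg zeta_weight_nonneg intro!: sum_nonneg mult_nonneg_nonneg)

text \<open>
  Letting the horizon grow gives the tail of the total number of jumps, and it removes the rejected
  steps: in the limit their term moves to the other side of the recursion.
\<close>
definition jump_tail :: "nat \<Rightarrow> nat \<Rightarrow> real" where
  "jump_tail j r = lim (\<lambda>N. jump_prob N j r)"

lemma jump_prob_tendsto: "(\<lambda>N. jump_prob N j r) \<longlonglongrightarrow> jump_tail j r"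
proof -
  have "incseq (\<lambda>N. jump_prob N j r)" using jump_prob_mono_Suc by (rule incseq_SucI)
  then obtain L where "(\<lambda>N. jump_prob N j r) \<longlonglongrightarrow> L"
    by (rule incseq_convergent[where B = 1]) (simp add: jump_prob_le_1)
  then show ?thesis unfolding jump_tail_def by (simp add: limI)
qed

lemma jump_tail_0: "jump_tail 0 r = 1"
  using jump_prob_tendsto[of 0 r] by (simp add: LIMSEQ_const_iff)

lemma jump_tail_nonneg: "0 \<le> jump_tail j r"
  using LIMSEQ_le_const[OF jump_prob_tendsto] jump_prob_nonneg by blast

lemma jump_tail_rec:
  "zeta_cdf r * jump_tail (Suc j) r = (\<Sum>k=2..r. zeta_weight k * jump_tail j (r - k))"
proof -
  have "(\<lambda>N. jump_prob (Suc N) (Suc j) r) \<longlonglongrightarrow> jump_tail (Suc j) r"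
    by (rule LIMSEQ_Suc[OF jump_prob_tendsto])
  moreover have "(\<lambda>N. jump_prob (Suc N) (Suc j) r) \<longlonglongrightarrow>
      (\<Sum>k=2..r. zeta_weight k * jump_tail j (r - k)) + (1 - zeta_cdf r) * jump_tail (Suc j) r"
    unfolding jump_prob.simps by (intro tendsto_intros jump_prob_tendsto)
  ultimately have "jump_tail (Suc j) r =
      (\<Sum>k=2..r. zeta_weight k * jump_tail j (r - k)) + (1 - zeta_cdf r) * jump_tail (Suc j) r"
    by (rule LIMSEQ_unique)
  then show ?thesis by (simp add: algebra_simps)
qed

text \<open>
  Both recursions have the same shape; only the coefficients differ, and those of the walk are
  larger. At the start of the induction, the walk almost surely jumps at least once if \<open>r \<ge> 2\<close>.
\<close>
lemma cut_survival_le_jump_tail: "cut_survival j r \<le> jump_tail (Suc j) r"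
proof (induction j arbitrary: r)
  case 0
  show ?case
  proof (cases "2 \<le> r")
    case True
    have "zeta_cdf r * jump_tail 1 r = zeta_cdf r * 1"
      using jump_tail_rec[of r 0] by (simp add: jump_tail_0 zeta_cdf_def)
    then show ?thesis using True zeta_cdf_pos[OF True] by simp
  qed (simp add: jump_tail_nonneg)
next
  case (Suc j)
  show ?case
  proof (cases "2 \<le> r")
    case True
    note pos = zeta_cdf_pos[OF True]
    have "zeta_cdf r * cut_survival (Suc j) r =
        zeta_cdf r * (real r / (real r - 1)) * (\<Sum>k=2..r. zeta_weight k * cut_survival j (r - k))"
      using True by simp
    also have "\<dots> \<le> zeta_cdf r * (real r / (real r - 1)) * (\<Sum>k=2..r. zeta_weight k * jump_tail (Suc j) (r - k))"
      using pos True Suc.IH zeta_weight_nonneg by (intro mult_left_mono sum_mono) auto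
    also have "\<dots> \<le> 1 * (\<Sum>k=2..r. zeta_weight k * jump_tail (Suc j) (r - k))"
      using zeta_cdf_le[OF True] zeta_weight_nonneg jump_tail_nonneg
      by (intro mult_right_mono sum_nonneg mult_nonneg_nonneg) auto
    also have "\<dots> = zeta_cdf r * jump_tail (Suc (Suc j)) r" by (simp add: jump_tail_rec)
    finally show ?thesis using pos by simp
  qed (simp add: jump_tail_nonneg)
qed

section \<open>The random walk with a barrier\<close>
definition jumps_between :: "nat \<Rightarrow> nat \<Rightarrow> nat \<Rightarrow> (nat \<Rightarrow> nat) \<Rightarrow> nat" where
  "jumps_between n t u x = card {i\<in>{t..<u}. barrier_walk (n + 1) x i + x (Suc i) \<le> n}"

lemma jumps_between_first:
  assumes "t < u"
  shows "jumps_between n t u x =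
    of_bool (barrier_walk (n + 1) x t + x (Suc t) \<le> n) + jumps_between n (Suc t) u x"
proof -
  have "{t..<u} = insert t {Suc t..<u}" using assms by auto
  then have "{i\<in>{t..<u}. barrier_walk (n + 1) x i + x (Suc i) \<le> n} =
      (if barrier_walk (n + 1) x t + x (Suc t) \<le> n then {t} else {}) \<union>
      {i\<in>{Suc t..<u}. barrier_walk (n + 1) x i + x (Suc i) \<le> n}" by auto
  then show ?thesis by (simp add: jumps_between_def)
qed

lemma jumps_between_le_num_jumps: "of_nat (jumps_between n 0 u x) \<le> num_jumps n x"
proof -
  have "(of_nat (jumps_between n 0 u x) :: ennreal) =
      (\<Sum>i<u. if barrier_walk (n + 1) x i + x (Suc i) \<le> n then 1 else 0)"
    by (simp add: jumps_between_def sum.If_cases lessThan_atLeast0 Int_def)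
  also have "\<dots> \<le> num_jumps n x" unfolding num_jumps_def by (intro sum_le_suminf) auto
  finally show ?thesis .
qed

context zeta_steps begin

lemma measurable_step [measurable]: "1 \<le> i \<Longrightarrow> \<xi> i \<in> measurable N (count_space UNIV)"
  using indep_steps by (simp add: indep_vars_def)

lemma measurable_barrier_walk [measurable]:
  "(\<lambda>\<omega>. barrier_walk m (\<lambda>i. \<xi> i \<omega>) t) \<in> measurable N (count_space UNIV)"
proof (induction t)
  case (Suc t)
  note [measurable] = Suc.IH measurable_step[of "Suc t", simplified]
  show ?case unfolding barrier_walk.simps by measurable
qed simp

lemma pred_jump [measurable]:
  "Measurable.pred N (\<lambda>\<omega>. barrier_walk m (\<lambda>i. \<xi> i \<omega>) t + \<xi> (Suc t) \<omega> \<le> n)"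
proof -
  note [measurable] = measurable_step[of "Suc t", simplified]
  have "(\<lambda>\<omega>. barrier_walk m (\<lambda>i. \<xi> i \<omega>) t + \<xi> (Suc t) \<omega>) \<in> measurable N (count_space UNIV)"
    by measurable
  from measurable_compose[OF this, of "\<lambda>k. k \<le> n" "count_space UNIV"] show ?thesis by simp
qed

lemma measurable_num_jumps [measurable]: "(\<lambda>\<omega>. num_jumps n (\<lambda>i. \<xi> i \<omega>)) \<in> borel_measurable N"
  unfolding num_jumps_def by measurable

lemma measurable_jumps_between [measurable]:
  "(\<lambda>\<omega>. jumps_between n t u (\<lambda>i. \<xi> i \<omega>)) \<in> measurable N (count_space UNIV)"
proof -
  have "jumps_between n t u x = (\<Sum>i\<in>{t..<u}. if barrier_walk (n + 1) x i + x (Suc i) \<le> n then 1 else 0)" for x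
    by (simp add: jumps_between_def sum.If_cases Int_def)
  then show ?thesis by (simp only:) measurable
qed

definition steps_in :: "nat \<Rightarrow> (nat \<Rightarrow> nat set) \<Rightarrow> 'b set" where
  "steps_in t A = {\<omega>\<in>space N. \<forall>i\<in>{1..t}. \<xi> i \<omega> \<in> A i}"

lemma event_steps_in: "steps_in t A \<in> events"
  unfolding steps_in_def
proof (rule sets.sets_Collect_finite_All[OF _ finite_atLeastAtMost])
  fix i assume "i \<in> {1..t}"
  then have [measurable]: "\<xi> i \<in> measurable N (count_space UNIV)" by simp
  show "{\<omega>\<in>space N. \<xi> i \<omega> \<in> A i} \<in> events" by measurable
qed

lemma prob_steps_in: "prob (steps_in t A) = (\<Prod>i\<in>{1..t}. \<P>(\<omega> in N. \<xi> i \<omega> \<in> A i))"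
proof (cases "t = 0")
  case True then show ?thesis by (simp add: prob_space steps_in_def)
next
  case False
  have "prob (\<Inter>i\<in>{1..t}. \<xi> i -` A i \<inter> space N) = (\<Prod>i\<in>{1..t}. prob (\<xi> i -` A i \<inter> space N))"
    by (rule indep_varsD[OF indep_steps]) (use False in auto)
  moreover have "(\<Inter>i\<in>{1..t}. \<xi> i -` A i \<inter> space N) = steps_in t A" using False by (auto simp: steps_in_def)
  ultimately show ?thesis by (simp add: vimage_def Int_def conj_commute)
qed

lemma prob_steps_in_Suc:
  "prob (steps_in (Suc t) (A(Suc t := B))) = prob (steps_in t A) * \<P>(\<omega> in N. \<xi> (Suc t) \<omega> \<in> B)"
  unfolding prob_steps_in by (simp add: atLeastAtMostSuc_conv)

lemma prob_step_eq:
  assumes "1 \<le> i" "2 \<le> k"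
  shows "\<P>(\<omega> in N. \<xi> i \<omega> \<in> {k}) = zeta_weight k"
  using step_law[OF assms] by (simp add: zeta_weight_def)

text \<open>
  Only the probabilities of steps \<open>k \<ge> 2\<close> are prescribed. Since they add up to one, the tail of
  a step is bounded below by a limit of finite sums.
\<close>
lemma prob_step_gt:
  assumes i: "1 \<le> i"
  shows "1 - zeta_cdf r \<le> \<P>(\<omega> in N. \<xi> i \<omega> \<in> {r<..})"
proof -
  note [measurable] = measurable_step[OF i]
  have interval: "\<P>(\<omega> in N. \<xi> i \<omega> \<in> {2..m}) = zeta_cdf m" for m
  proof -
    have "{\<omega>\<in>space N. \<xi> i \<omega> \<in> {2..m}} = (\<Union>k\<in>{2..m}. {\<omega>\<in>space N. \<xi> i \<omega> \<in> {k}})" by auto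
    then have "\<P>(\<omega> in N. \<xi> i \<omega> \<in> {2..m}) = (\<Sum>k=2..m. \<P>(\<omega> in N. \<xi> i \<omega> \<in> {k}))"
      by (simp only:) (rule finite_measure_finite_Union, auto simp: disjoint_family_on_def)
    then show ?thesis using i by (simp only: zeta_cdf_def) (intro sum.cong refl prob_step_eq, auto)
  qed
  have "zeta_cdf m - zeta_cdf r \<le> \<P>(\<omega> in N. \<xi> i \<omega> \<in> {r<..})" for m
  proof -
    have "\<P>(\<omega> in N. \<xi> i \<omega> \<in> {2..m}) \<le> prob ({\<omega>\<in>space N. \<xi> i \<omega> \<in> {2..r}} \<union> {\<omega>\<in>space N. \<xi> i \<omega> \<in> {r<..}})"
      by (intro finite_measure_mono) auto
    also have "\<dots> \<le> \<P>(\<omega> in N. \<xi> i \<omega> \<in> {2..r}) + \<P>(\<omega> in N. \<xi> i \<omega> \<in> {r<..})"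
      by (intro measure_Un_le) auto
    finally show ?thesis by (simp only: interval)
  qed
  moreover have "(\<lambda>m. zeta_cdf m - zeta_cdf r) \<longlonglongrightarrow> 1 - zeta_cdf r"
    by (intro tendsto_intros zeta_cdf_tendsto)
  ultimately show ?thesis using LIMSEQ_le_const2 by blast
qed

text \<open>
  The past is an event restricting the first \<open>t\<close> steps to sets \<open>A i\<close> that determine the current
  position. Sets rather than single values are used because a rejected step is conditioned only
  on being larger than \<open>r\<close>; then independence of the steps gives the recursion of \<open>jump_prob\<close>.
\<close>
lemma prob_jumps_between_ge:
  assumes "\<And>\<omega>. \<omega> \<in> steps_in t A \<Longrightarrow> barrier_walk (n + 1) (\<lambda>i. \<xi> i \<omega>) t = n - r" and "r \<le> n"
  shows "prob (steps_in t A) * jump_prob K j r \<le>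
    prob (steps_in t A \<inter> {\<omega>\<in>space N. j \<le> jumps_between n t (t + K) (\<lambda>i. \<xi> i \<omega>)})"
  using assms
proof (induction K j r arbitrary: t A rule: jump_prob.induct)
  case (1 K r)
  have "steps_in t A \<inter> {\<omega>\<in>space N. 0 \<le> jumps_between n t (t + K) (\<lambda>i. \<xi> i \<omega>)} = steps_in t A"
    by (auto simp: steps_in_def)
  then show ?case by simp
next
  case (2 j r)
  then show ?case by simp
next
  case (3 K j r)
  define ext where "ext B = A(Suc t := B)" for B
  define goal where "goal = {\<omega>\<in>space N. Suc j \<le> jumps_between n t (t + Suc K) (\<lambda>i. \<xi> i \<omega>)}"
  have ev_goal: "goal \<in> events" unfolding goal_def by measurable
  have ext_iff: "\<omega> \<in> steps_in (Suc t) (ext B) \<longleftrightarrow> \<omega> \<in> steps_in t A \<and> \<xi> (Suc t) \<omega> \<in> B" for \<omega> B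
    by (auto simp: ext_def steps_in_def atLeastAtMostSuc_conv)
  have walk: "barrier_walk (n + 1) (\<lambda>i. \<xi> i \<omega>) t = n - r" if "\<omega> \<in> steps_in (Suc t) (ext B)" for \<omega> B
    by (rule "3.prems"(1)) (use that ext_iff in blast)
  have prob_ext: "prob (steps_in (Suc t) (ext B)) = prob (steps_in t A) * \<P>(\<omega> in N. \<xi> (Suc t) \<omega> \<in> B)" for B
    unfolding ext_def by (rule prob_steps_in_Suc)
  have jump: "prob (steps_in t A) * (zeta_weight k * jump_prob K j (r - k)) \<le>
      prob (steps_in (Suc t) (ext {k}) \<inter> goal)" if k: "k \<in> {2..r}" for k
  proof -
    have "prob (steps_in (Suc t) (ext {k})) * jump_prob K j (r - k) \<le>
        prob (steps_in (Suc t) (ext {k}) \<inter>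
          {\<omega>\<in>space N. j \<le> jumps_between n (Suc t) (Suc t + K) (\<lambda>i. \<xi> i \<omega>)})"
    proof (rule "3.IH"(1)[OF k, of "Suc t" "ext {k}"])
      fix \<omega> assume w: "\<omega> \<in> steps_in (Suc t) (ext {k})"
      have "\<xi> (Suc t) \<omega> = k" using w ext_iff[of \<omega> "{k}"] by simp
      moreover have "n - r + k < n + 1" "n - r + k = n - (r - k)" using k "3.prems"(2) by auto
      ultimately show "barrier_walk (n + 1) (\<lambda>i. \<xi> i \<omega>) (Suc t) = n - (r - k)"
        unfolding barrier_walk.simps walk[OF w] by simp
    qed (use "3.prems"(2) in simp)
    also have "\<dots> \<le> prob (steps_in (Suc t) (ext {k}) \<inter> goal)"
    proof (intro finite_measure_mono sets.Int event_steps_in ev_goal subsetI)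
      fix \<omega> assume w: "\<omega> \<in> steps_in (Suc t) (ext {k}) \<inter>
          {\<omega>\<in>space N. j \<le> jumps_between n (Suc t) (Suc t + K) (\<lambda>i. \<xi> i \<omega>)}"
      then have w': "\<omega> \<in> steps_in (Suc t) (ext {k})" by blast
      have "\<xi> (Suc t) \<omega> = k" using w' ext_iff[of \<omega> "{k}"] by simp
      then have "barrier_walk (n + 1) (\<lambda>i. \<xi> i \<omega>) t + \<xi> (Suc t) \<omega> \<le> n"
        unfolding walk[OF w'] using k "3.prems"(2) by auto
      then have "Suc j \<le> jumps_between n t (t + Suc K) (\<lambda>i. \<xi> i \<omega>)"
        using w by (simp add: jumps_between_first[of t "Suc (t + K)"])
      then show "\<omega> \<in> steps_in (Suc t) (ext {k}) \<inter> goal" using w by (auto simp: goal_def)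
    qed
    finally show ?thesis by (simp add: prob_ext prob_step_eq[of "Suc t" k, simplified] k[simplified] mult.assoc)
  qed
  have reject: "prob (steps_in t A) * ((1 - zeta_cdf r) * jump_prob K (Suc j) r) \<le>
      prob (steps_in (Suc t) (ext {r<..}) \<inter> goal)"
  proof -
    have "prob (steps_in t A) * ((1 - zeta_cdf r) * jump_prob K (Suc j) r) \<le>
        prob (steps_in t A) * (\<P>(\<omega> in N. \<xi> (Suc t) \<omega> \<in> {r<..}) * jump_prob K (Suc j) r)"
      by (intro mult_left_mono mult_right_mono prob_step_gt jump_prob_nonneg) auto
    also have "\<dots> = prob (steps_in (Suc t) (ext {r<..})) * jump_prob K (Suc j) r"
      by (simp only: prob_ext mult.assoc)
    also have "\<dots> \<le> prob (steps_in (Suc t) (ext {r<..}) \<inter>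
          {\<omega>\<in>space N. Suc j \<le> jumps_between n (Suc t) (Suc t + K) (\<lambda>i. \<xi> i \<omega>)})"
    proof (rule "3.IH"(2)[of "Suc t" "ext {r<..}"])
      fix \<omega> assume w: "\<omega> \<in> steps_in (Suc t) (ext {r<..})"
      have "r < \<xi> (Suc t) \<omega>" using w ext_iff[of \<omega> "{r<..}"] by simp
      then have "\<not> n - r + \<xi> (Suc t) \<omega> < n + 1" using "3.prems"(2) by simp
      then show "barrier_walk (n + 1) (\<lambda>i. \<xi> i \<omega>) (Suc t) = n - r"
        unfolding barrier_walk.simps walk[OF w] by simp
    qed (use "3.prems"(2) in simp)
    also have "\<dots> \<le> prob (steps_in (Suc t) (ext {r<..}) \<inter> goal)"
    proof (intro finite_measure_mono sets.Int event_steps_in ev_goal subsetI)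
      fix \<omega> assume w: "\<omega> \<in> steps_in (Suc t) (ext {r<..}) \<inter>
          {\<omega>\<in>space N. Suc j \<le> jumps_between n (Suc t) (Suc t + K) (\<lambda>i. \<xi> i \<omega>)}"
      then have "Suc j \<le> jumps_between n t (t + Suc K) (\<lambda>i. \<xi> i \<omega>)"
        by (simp add: jumps_between_first[of t "Suc (t + K)"])
      then show "\<omega> \<in> steps_in (Suc t) (ext {r<..}) \<inter> goal" using w by (auto simp: goal_def)
    qed
    finally show ?thesis .
  qed
  define U where "U = (\<Union>k\<in>{2..r}. steps_in (Suc t) (ext {k}) \<inter> goal)"
  have ev: "steps_in (Suc t) (ext B) \<inter> goal \<in> events" for B
    using event_steps_in ev_goal by (rule sets.Int)
  have "prob (steps_in t A) * jump_prob (Suc K) (Suc j) r =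
      (\<Sum>k=2..r. prob (steps_in t A) * (zeta_weight k * jump_prob K j (r - k))) +
      prob (steps_in t A) * ((1 - zeta_cdf r) * jump_prob K (Suc j) r)"
    by (simp add: distrib_left sum_distrib_left)
  also have "\<dots> \<le> (\<Sum>k=2..r. prob (steps_in (Suc t) (ext {k}) \<inter> goal)) +
      prob (steps_in (Suc t) (ext {r<..}) \<inter> goal)"
    using jump reject by (intro add_mono sum_mono) auto
  also have "(\<Sum>k=2..r. prob (steps_in (Suc t) (ext {k}) \<inter> goal)) = prob U"
    unfolding U_def
  proof (rule finite_measure_finite_Union[symmetric])
    show "disjoint_family_on (\<lambda>k. steps_in (Suc t) (ext {k}) \<inter> goal) {2..r}"
    proof (unfold disjoint_family_on_def, intro ballI impI equals0I)
      fix k l \<omega> assume "k \<noteq> l"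
        and w: "\<omega> \<in> steps_in (Suc t) (ext {k}) \<inter> goal \<inter> (steps_in (Suc t) (ext {l}) \<inter> goal)"
      have "\<xi> (Suc t) \<omega> = k" "\<xi> (Suc t) \<omega> = l"
        using w ext_iff[of \<omega> "{k}"] ext_iff[of \<omega> "{l}"] by simp_all
      with \<open>k \<noteq> l\<close> show False by simp
    qed
  qed (simp_all add: image_subset_iff ev)
  also have "prob U + prob (steps_in (Suc t) (ext {r<..}) \<inter> goal) =
      prob (U \<union> (steps_in (Suc t) (ext {r<..}) \<inter> goal))"
  proof (rule finite_measure_Union[symmetric])
    show "U \<inter> (steps_in (Suc t) (ext {r<..}) \<inter> goal) = {}"
    proof (rule equals0I)
      fix \<omega> assume "\<omega> \<in> U \<inter> (steps_in (Suc t) (ext {r<..}) \<inter> goal)"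
      then obtain k where "k \<in> {2..r}" "\<omega> \<in> steps_in (Suc t) (ext {k})" "\<omega> \<in> steps_in (Suc t) (ext {r<..})"
        unfolding U_def by blast
      then show False using ext_iff[of \<omega> "{k}"] ext_iff[of \<omega> "{r<..}"] by simp
    qed
    show "U \<in> events" unfolding U_def by (intro sets.finite_UN ev) simp
  qed (rule ev)
  also have "\<dots> \<le> prob (steps_in t A \<inter> goal)"
  proof (intro finite_measure_mono sets.Int event_steps_in ev_goal subsetI)
    fix \<omega> assume "\<omega> \<in> U \<union> (steps_in (Suc t) (ext {r<..}) \<inter> goal)"
    then obtain B where "\<omega> \<in> steps_in (Suc t) (ext B)" "\<omega> \<in> goal" unfolding U_def by blast
    then show "\<omega> \<in> steps_in t A \<inter> goal" using ext_iff[of \<omega> B] by simp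
  qed
  finally show ?case by (simp only: goal_def)
qed

lemma prob_num_jumps_ge: "jump_tail j n \<le> \<P>(\<omega> in N. of_nat j \<le> num_jumps n (\<lambda>i. \<xi> i \<omega>))"
proof (rule LIMSEQ_le_const2[OF jump_prob_tendsto], intro exI allI impI)
  fix K :: nat
  have "jump_prob K j n \<le> \<P>(\<omega> in N. j \<le> jumps_between n 0 (0 + K) (\<lambda>i. \<xi> i \<omega>))"
    using prob_jumps_between_ge[of 0 "\<lambda>_. UNIV" n n K j] by (simp add: prob_space steps_in_def Int_absorb1)
  also have "\<dots> \<le> \<P>(\<omega> in N. of_nat j \<le> num_jumps n (\<lambda>i. \<xi> i \<omega>))"
  proof (intro finite_measure_mono subsetI)
    fix \<omega> assume w: "\<omega> \<in> {\<omega>\<in>space N. j \<le> jumps_between n 0 (0 + K) (\<lambda>i. \<xi> i \<omega>)}"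
    then have "(of_nat j :: ennreal) \<le> of_nat (jumps_between n 0 (0 + K) (\<lambda>i. \<xi> i \<omega>))" by simp
    also have "\<dots> \<le> num_jumps n (\<lambda>i. \<xi> i \<omega>)" by (rule jumps_between_le_num_jumps)
    finally show "\<omega> \<in> {\<omega>\<in>space N. of_nat j \<le> num_jumps n (\<lambda>i. \<xi> i \<omega>)}" using w by simp
  qed measurable
  finally show "jump_prob K j n \<le> \<P>(\<omega> in N. of_nat j \<le> num_jumps n (\<lambda>i. \<xi> i \<omega>))" .
qed

end

section \<open>Stochastic domination\<close>

theorem theorem1p5:
  fixes n :: nat
    and M :: "'a measure" and G :: "nat \<Rightarrow> 'a \<Rightarrow> ltree"
    and N :: "'b measure" and \<xi> :: "nat \<Rightarrow> 'b \<Rightarrow> nat"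
  assumes "n \<ge> 2"
    and "degree_biased_process M n G"
    and "zeta_steps N \<xi>"
  shows "\<forall>j::nat. \<P>(\<omega> in N. num_jumps n (\<lambda>i. \<xi> i \<omega>) \<ge> of_nat j)
                 \<ge> \<P>(\<omega> in M. num_cuts (\<lambda>t. G t \<omega>) \<ge> j)"
proof
  fix j :: nat
  interpret G: degree_biased_process M n G by fact
  interpret walk: zeta_steps N \<xi> by fact
  show "\<P>(\<omega> in M. num_cuts (\<lambda>t. G t \<omega>) \<ge> j) \<le>
    \<P>(\<omega> in N. num_jumps n (\<lambda>i. \<xi> i \<omega>) \<ge> of_nat j)"
  proof (cases j)
    case 0
    have "\<P>(\<omega> in M. num_cuts (\<lambda>t. G t \<omega>) \<ge> 0) \<le> jump_tail 0 n"
      by (simp add: jump_tail_0)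
    also have "\<dots> \<le> \<P>(\<omega> in N. num_jumps n (\<lambda>i. \<xi> i \<omega>) \<ge> of_nat 0)"
      by (rule walk.prob_num_jumps_ge)
    finally show ?thesis unfolding 0 .
  next
    case (Suc i)
    have "\<P>(\<omega> in M. num_cuts (\<lambda>t. G t \<omega>) \<ge> Suc i) \<le> cut_survival i n"
      using \<open>n \<ge> 2\<close> by (rule G.prob_num_cuts_le)
    also have "\<dots> \<le> jump_tail (Suc i) n" by (rule cut_survival_le_jump_tail)
    also have "\<dots> \<le> \<P>(\<omega> in N. num_jumps n (\<lambda>i. \<xi> i \<omega>) \<ge> of_nat (Suc i))"
      by (rule walk.prob_num_jumps_ge)
    finally show ?thesis unfolding Suc .
  qed
qed

end
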